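(* Let $\mathcal{P}$ denote the portrait $8(4)$. (a) For every prime $p$ and every residue class $\mathfrak{c}\in\mathbb{Z}/p\mathbb{Z}$, there exist infinitely many squarefree integers $d\in\mathfrak{c}$ such that $X_1(\mathcal{P})$ has a quadratic point defined over $\mathbb{Q}(\sqrt d)$. (b) There exist infinitely many imaginary quadratic fields $K$ with class number divisible by $10$ such that $X_1(\mathcal{P})$ has a quadratic point defined over $K$.
   Context: A portrait is a directed graph in which every vertex has out-degree 1. The portrait $8(4)$ consists of a directed 4-cycle together with, for each vertex of the cycle, one additional vertex mapping to it. For a finite portrait $\mathcal{P}$ with vertices $1,\dots,n$ and edges $i\to\varphi(i)$, $Y_1(\mathcal{P})$ is the affine curve over $\mathbb{Q}$ with coordinates $(c,z_1,\dots,z_n)$ given by $z_i^2+c=z_{\varphi(i)}$ for all $i$ together with the open conditions $z_i\ne z_j$ for $i\neq j$; it parametrizes maps $f_c(z)=z^2+c$ together with marked preperiodic points forming a copy of $\mathcal{P}$. $X_1(\mathcal{P})$ is the smooth projective curve over $\mathbb{Q}$ birational to $Y_1(\mathcal{P})$. For $\mathcal{P}=8(4)$, $X_1(\mathcal{P})$ is the smooth projective hyperelliptic (genus 2) curve with affine model $y^2=-x(x^2+1)(x^2-2x-1)$ over $\mathbb{Q}$ (it is isomorphic to the classical modular curve $X_1(16)$ parametrizing elliptic curves with a torsion point of order 16). A quadratic point on a curve over $\mathbb{Q}$ is a point whose field of definition is a quadratic extension of $\mathbb{Q}$; it is a quadratic point defined over $K$ if this field of definition is the quadratic field $K$. *)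

theory Defs
  imports
    "HOL-Algebra.Embedded_Algebras"
    "HOL-Algebra.Generated_Fields"
    "HOL-Computational_Algebra.Polynomial"
    "HOL-Computational_Algebra.Squarefree"
    "HOL-Number_Theory.Cong"
begin

section \<open>Number fields as subfields of the complex numbers\<close>

definition complex_field :: "complex ring" where
  "complex_field = \<lparr>carrier = UNIV, monoid.mult = (*), one = 1, zero = 0, add = (+)\<rparr>"

definition quadratic_field :: "complex set \<Rightarrow> bool" where
  "quadratic_field K \<longleftrightarrow> subfield K complex_field \<and> ring.dimension complex_field 2 \<rat> K"

definition imaginary_quadratic_field :: "complex set \<Rightarrow> bool" where
  "imaginary_quadratic_field K \<longleftrightarrow> quadratic_field K \<and> \<not> K \<subseteq> \<real>"

definition rat_adjoin_sqrt :: "int \<Rightarrow> complex set" where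
  "rat_adjoin_sqrt d = generate_field complex_field {csqrt (of_int d)}"

definition ring_of_integers :: "complex set \<Rightarrow> complex ring" where
  "ring_of_integers K = complex_field\<lparr>carrier := {x \<in> K. algebraic_int x}\<rparr>"

definition nonzero_ideals :: "complex set \<Rightarrow> complex set set" where
  "nonzero_ideals K = {I. ideal I (ring_of_integers K) \<and> I \<noteq> {0}}"

text \<open>Two nonzero ideals are in the same class iff they agree up to principal factors.\<close>

definition ideal_class_rel :: "complex set \<Rightarrow> (complex set \<times> complex set) set" where
  "ideal_class_rel K = {(I, J). I \<in> nonzero_ideals K \<and> J \<in> nonzero_ideals K \<and>
     (\<exists>a \<in> carrier (ring_of_integers K) - {0}. \<exists>b \<in> carrier (ring_of_integers K) - {0}.
        (*) a ` I = (*) b ` J)}"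

definition class_number :: "complex set \<Rightarrow> nat" where
  "class_number K = card (nonzero_ideals K // ideal_class_rel K)"

section \<open>The curve \<open>X\<^sub>1(\<P>)\<close> for the portrait \<open>8(4)\<close>\<close>

text \<open>
  The smooth projective curve with affine model \<open>y\<^sup>2 = - x (x\<^sup>2 + 1) (x\<^sup>2 - 2 x - 1)\<close> is
  the curve \<open>Y\<^sup>2 = F(X, Z)\<close> in the weighted projective plane \<open>\<bbbP>(1, 3, 1)\<close>, where \<open>F\<close> is
  the right-hand side homogenized in degree 6. (The closure of the affine model in the ordinary
  projective plane is singular at infinity.) The single point with \<open>Z = 0\<close> is \<open>[1 : 0 : 0]\<close>.
\<close>

definition X1_form :: "'k::field \<Rightarrow> 'k \<Rightarrow> 'k" where
  "X1_form X Z = - X * Z * (X\<^sup>2 + Z\<^sup>2) * (X\<^sup>2 - 2 * X * Z - Z\<^sup>2)"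

definition X1_cone :: "(complex \<times> complex \<times> complex) set" where
  "X1_cone = {(X, Y, Z). Y\<^sup>2 = X1_form X Z \<and> (X, Z) \<noteq> (0, 0)}"

definition weighted_rel :: "((complex \<times> complex \<times> complex) \<times> (complex \<times> complex \<times> complex)) set" where
  "weighted_rel = {((X, Y, Z), (X', Y', Z')). (X, Y, Z) \<in> X1_cone \<and>
     (\<exists>t. t \<noteq> 0 \<and> X' = t * X \<and> Y' = t ^ 3 * Y \<and> Z' = t * Z)}"

definition X1 :: "(complex \<times> complex \<times> complex) set set" where
  "X1 = X1_cone // weighted_rel"

text \<open>
  Dividing by \<open>X\<close> or by \<open>Z\<close> turns coordinates over \<open>L\<close> into affine coordinates over \<open>L\<close> in one of
  the two standard charts, so a point is defined over \<open>L\<close> iff it has coordinates in \<open>L\<close>.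
\<close>

definition field_of_definition :: "(complex \<times> complex \<times> complex) set \<Rightarrow> complex set" where
  "field_of_definition P = \<Inter> {L. subfield L complex_field \<and> P \<inter> (L \<times> L \<times> L) \<noteq> {}}"

definition X1_has_quadratic_point_over :: "complex set \<Rightarrow> bool" where
  "X1_has_quadratic_point_over K \<longleftrightarrow>
     quadratic_field K \<and> (\<exists>P \<in> X1. field_of_definition P = K)"

section \<open>Relation to the portrait\<close>

text \<open>
  The theorem below makes precise, over every field of characteristic 0, that \<open>X1\<close> is birational
  to the curve \<open>Y\<^sub>1(8(4))\<close> of quadratic polynomials with a marked portrait: the classical
  parametrization of 4-cycles of \<open>z\<^sup>2 + c\<close> identifies the two curves away from finitely many
  points, with inverse \<open>x = (1 + s) / (1 - s)\<close>, \<open>y = (z\<^sub>0 - z\<^sub>2) x (x - 1)\<close>, \<open>s = z\<^sub>0 + z\<^sub>2\<close>.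
\<close>

definition Y1 :: "'v set \<Rightarrow> ('v \<Rightarrow> 'v) \<Rightarrow> ('k::field \<times> ('v \<Rightarrow> 'k)) set" where
  "Y1 V \<phi> = {(c, z). z \<in> extensional V \<and> (\<forall>i\<in>V. (z i)\<^sup>2 + c = z (\<phi> i)) \<and> inj_on z V}"

text \<open>\<open>8(4)\<close> has the cycle \<open>0 \<mapsto> 1 \<mapsto> 2 \<mapsto> 3 \<mapsto> 0\<close>, and \<open>i + 4\<close> has the same image as \<open>i\<close>.\<close>

definition portrait_8_4_vertices :: "nat set" where
  "portrait_8_4_vertices = {..<8}"

definition portrait_8_4_map :: "nat \<Rightarrow> nat" where
  "portrait_8_4_map i = Suc i mod 4"

definition cycle_point :: "'k::field \<Rightarrow> 'k \<Rightarrow> nat \<Rightarrow> 'k" where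
  "cycle_point x y i =
     [((x - 1) / (x + 1) + y / (x * (x - 1))) / 2,
      (- (x + 1) / (x - 1) + y / (x * (x + 1))) / 2,
      ((x - 1) / (x + 1) - y / (x * (x - 1))) / 2,
      (- (x + 1) / (x - 1) - y / (x * (x + 1))) / 2] ! i"

definition marking :: "'k::field \<Rightarrow> 'k \<Rightarrow> nat \<Rightarrow> 'k" where
  "marking x y = (\<lambda>i\<in>portrait_8_4_vertices.
     if i < 4 then cycle_point x y i else - cycle_point x y (i - 4))"

definition marked_parameter :: "'k::field \<Rightarrow> 'k" where
  "marked_parameter x = (x\<^sup>2 - 4 * x - 1) * (x ^ 4 + x ^ 3 + 2 * x\<^sup>2 - x + 1)
     / (4 * x * (x - 1)\<^sup>2 * (x + 1)\<^sup>2)"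

definition X1_open :: "('k::field \<times> 'k) set" where
  "X1_open = {(x, y). y\<^sup>2 = X1_form x 1 \<and> y \<noteq> 0 \<and> x \<noteq> 1 \<and> x \<noteq> - 1 \<and>
     (\<forall>i<4. cycle_point x y i \<noteq> 0)}"

lemma eqD: "a = b \<Longrightarrow> a - b = (0 :: 'k::field)"
  by simp

lemma ball_lt_4: "(\<forall>i<4::nat. P i) \<longleftrightarrow> P 0 \<and> P 1 \<and> P 2 \<and> P 3"
  by (auto simp: eval_nat_numeral All_less_Suc)

lemma ball_lt_8:
  "(\<forall>i<8::nat. P i) \<longleftrightarrow> P 0 \<and> P 1 \<and> P 2 \<and> P 3 \<and> P 4 \<and> P 5 \<and> P 6 \<and> P 7"
  by (auto simp: eval_nat_numeral All_less_Suc)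

lemma Y1_8_4_iff:
  fixes z :: "nat \<Rightarrow> 'k::field_char_0"
  shows "(c, z) \<in> Y1 portrait_8_4_vertices portrait_8_4_map \<longleftrightarrow>
    z \<in> extensional {..<8} \<and> (z 0)\<^sup>2 + c = z 1 \<and> (z 1)\<^sup>2 + c = z 2 \<and> (z 2)\<^sup>2 + c = z 3 \<and>
    (z 3)\<^sup>2 + c = z 0 \<and> z 0 \<noteq> z 2 \<and> z 1 \<noteq> z 3 \<and>
    z 0 \<noteq> 0 \<and> z 1 \<noteq> 0 \<and> z 2 \<noteq> 0 \<and> z 3 \<noteq> 0 \<and>
    z 4 = - z 0 \<and> z 5 = - z 1 \<and> z 6 = - z 2 \<and> z 7 = - z 3" (is "?L \<longleftrightarrow> ?R")
proof
  assume L: ?L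
  have inj: "inj_on z {..<8}"
    and eq: "\<And>i. i < 8 \<Longrightarrow> (z i)\<^sup>2 + c = z (Suc i mod 4)" and e: "z \<in> extensional {..<8}"
    using L by (auto simp: Y1_def portrait_8_4_vertices_def portrait_8_4_map_def)
  have ne: "z i \<noteq> z j" if "i < 8" "j < 8" "i \<noteq> j" for i j
    using inj that by (auto simp: inj_on_def)
  have m: "z (i + 4) = - z i" if "i < 4" for i
  proof -
    have "Suc (i + 4) mod 4 = Suc i mod 4" by presburger
    then have "(z (i + 4))\<^sup>2 + c = (z i)\<^sup>2 + c" using eq[of i] eq[of "i + 4"] that
      by simp
    then have "(z (i + 4))\<^sup>2 = (z i)\<^sup>2" by simp
    moreover have "z (i + 4) \<noteq> z i" using ne[of "i + 4" i] that by auto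
    ultimately show ?thesis by (auto simp: power2_eq_iff)
  qed
  have nz: "z i \<noteq> 0" if "i < 4" for i
    using m[OF that] ne[of "i + 4" i] that by auto
  have s: "Suc 0 mod 4 = 1" "Suc 1 mod 4 = (2::nat)" "Suc 2 mod 4 = 3" "Suc 3 mod 4 = 0"
    "0 + 4 = (4::nat)" "1 + 4 = (5::nat)" "2 + 4 = (6::nat)" "3 + 4 = (7::nat)"
    by simp_all
  have "(z 0)\<^sup>2 + c = z 1" "(z 1)\<^sup>2 + c = z 2" "(z 2)\<^sup>2 + c = z 3" "(z 3)\<^sup>2 + c = z 0"
    using eq[of 0] eq[of 1] eq[of 2] eq[of 3] unfolding s by simp_all
  moreover have "z 4 = - z 0" "z 5 = - z 1" "z 6 = - z 2" "z 7 = - z 3"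
    using m[of 0] m[of 1] m[of 2] m[of 3] unfolding s by simp_all
  ultimately show ?R
    using e ne[of 0 2] ne[of 1 3] nz[of 0] nz[of 1] nz[of 2] nz[of 3] by simp
next
  assume R: ?R
  then have e: "(z 0)\<^sup>2 + c = z 1" "(z 1)\<^sup>2 + c = z 2" "(z 2)\<^sup>2 + c = z 3" "(z 3)\<^sup>2 + c = z 0"
    and ne: "z 0 \<noteq> z 2" "z 1 \<noteq> z 3" by blast+
  have sq: "(z 0)\<^sup>2 \<noteq> (z 1)\<^sup>2" "(z 1)\<^sup>2 \<noteq> (z 2)\<^sup>2" "(z 2)\<^sup>2 \<noteq> (z 3)\<^sup>2" "(z 3)\<^sup>2 \<noteq> (z 0)\<^sup>2"
    "(z 0)\<^sup>2 \<noteq> (z 2)\<^sup>2" "(z 1)\<^sup>2 \<noteq> (z 3)\<^sup>2"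
    using e ne by metis+
  have sqD: "a \<noteq> b \<and> b \<noteq> a \<and> a \<noteq> - b \<and> - b \<noteq> a \<and> - a \<noteq> b \<and> b \<noteq> - a"
    if "a\<^sup>2 \<noteq> b\<^sup>2" for a b :: 'k using that by auto
  have self: "x \<noteq> - x" if "x \<noteq> 0" for x :: 'k
  proof
    assume "x = - x"
    then have "2 * x = 0" by (metis add.right_inverse mult_2)
    then show False using that by simp
  qed
  have self': "- x \<noteq> x" if "x \<noteq> 0" for x :: 'k
    using self[OF that] by metis
  have n: "z 0 \<noteq> 0" "z 1 \<noteq> 0" "z 2 \<noteq> 0" "z 3 \<noteq> 0"
    and m: "z 4 = - z 0" "z 5 = - z 1" "z 6 = - z 2" "z 7 = - z 3"
    using R by blast+
  note q = sq[THEN sqD]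
  have "\<forall>i<8. \<forall>j<8. i \<noteq> j \<longrightarrow> z i \<noteq> z j"
    unfolding ball_lt_8 m neg_equal_iff_equal
    by (intro conjI impI; (simp; fail | insert q n self[OF n(1)] self[OF n(2)] self[OF n(3)] self[OF n(4)]
        self'[OF n(1)] self'[OF n(2)] self'[OF n(3)] self'[OF n(4)], argo))
  note d = this
  have "inj_on z {..<8}"
  proof (rule inj_onI, rule ccontr)
    fix i j :: nat assume ij: "i \<in> {..<8}" "j \<in> {..<8}" "z i = z j" "i \<noteq> j"
    have "i < 8" "j < 8" using ij(1,2) by simp_all
    from d[rule_format, OF this ij(4)] ij(3) show False by contradiction
  qed
  moreover have s: "Suc 0 mod 4 = 1" "Suc 1 mod 4 = (2::nat)" "Suc 2 mod 4 = 3" "Suc 3 mod 4 = 0"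
    "Suc 4 mod 4 = 1" "Suc 5 mod 4 = (2::nat)" "Suc 6 mod 4 = 3" "Suc 7 mod 4 = 0"
    by simp_all
  have "\<forall>i<8. (z i)\<^sup>2 + c = z (Suc i mod 4)"
    unfolding ball_lt_8 s m power2_minus using e by blast
  ultimately show ?L
    using R by (simp add: Y1_def portrait_8_4_vertices_def portrait_8_4_map_def)
qed

lemma cycle_point_nth:
  "cycle_point x y 0 = ((x - 1) / (x + 1) + y / (x * (x - 1))) / 2"
  "cycle_point x y 1 = (- (x + 1) / (x - 1) + y / (x * (x + 1))) / 2"
  "cycle_point x y 2 = ((x - 1) / (x + 1) - y / (x * (x - 1))) / 2"
  "cycle_point x y 3 = (- (x + 1) / (x - 1) - y / (x * (x + 1))) / 2"
  by (simp_all add: cycle_point_def numeral_3_eq_3 numeral_2_eq_2)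

lemma cycle_point_equations:
  fixes x y :: "'k::field_char_0"
  assumes y: "y\<^sup>2 = X1_form x 1" and x: "x \<noteq> 0" "x \<noteq> 1" "x \<noteq> - 1"
  defines "z \<equiv> cycle_point x y" and "c \<equiv> marked_parameter x"
  shows "(z 0)\<^sup>2 + c = z 1 \<and> (z 1)\<^sup>2 + c = z 2 \<and> (z 2)\<^sup>2 + c = z 3 \<and> (z 3)\<^sup>2 + c = z 0"
proof -
  define s D u E where "s = (x - 1) / (x + 1)" and "D = y / (x * (x - 1))"
    and "u = - (x + 1) / (x - 1)" and "E = y / (x * (x + 1))"
  have nz: "x \<noteq> 0" "x - 1 \<noteq> 0" "x + 1 \<noteq> 0"
    using x by (auto simp: add_eq_0_iff2)
  have two: "2 * (a / 2) = a" for a :: 'k by simp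
  have z: "2 * z 0 = s + D" "2 * z 1 = u + E" "2 * z 2 = s - D" "2 * z 3 = u - E"
    unfolding z_def cycle_point_nth s_def D_def u_def E_def by (rule two)+
  have s: "s * (x + 1) = x - 1" and u: "u * (x - 1) = - (x + 1)"
    and E': "E * (x * (x + 1)) = y" and D': "D * (x * (x - 1)) = y"
    and c: "c * (4 * x * (x - 1)\<^sup>2 * (x + 1)\<^sup>2) = (x\<^sup>2 - 4 * x - 1) * (x ^ 4 + x ^ 3 + 2 * x\<^sup>2 - x + 1)"
    using nz by (simp_all add: s_def u_def D_def E_def c_def marked_parameter_def)
  have "E * (x * (x + 1)) = (D * s) * (x * (x + 1))"
    using E'[THEN eqD] D'[THEN eqD] s[THEN eqD] by Groebner_Basis.algebra
  then have E: "E = D * s" using nz by simp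
  have "(u * s) * ((x - 1) * (x + 1)) = - 1 * ((x - 1) * (x + 1))" using u[THEN eqD] s[THEN eqD] by Groebner_Basis.algebra
  then have us: "u * s = - 1" using nz by (metis mult_right_cancel no_zero_divisors)
  have y': "y\<^sup>2 = - x * (x\<^sup>2 + 1) * (x\<^sup>2 - 2 * x - 1)"
    using y by (simp add: X1_form_def)
  have "x * (D\<^sup>2 * (x * (x - 1)\<^sup>2)) = x * - ((x\<^sup>2 + 1) * (x\<^sup>2 - 2 * x - 1))"
    using D'[THEN eqD] y'[THEN eqD] by Groebner_Basis.algebra
  then have D: "D\<^sup>2 * (x * (x - 1)\<^sup>2) = - ((x\<^sup>2 + 1) * (x\<^sup>2 - 2 * x - 1))"
    using nz by (metis mult_left_cancel)
  let ?m = "x * (x - 1)\<^sup>2 * (x + 1)\<^sup>2"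
  have m: "?m \<noteq> 0" using nz by simp
  have s2: "s\<^sup>2 * (x + 1)\<^sup>2 = (x - 1)\<^sup>2" using s[THEN eqD] by Groebner_Basis.algebra
  have u2: "u\<^sup>2 * (x - 1)\<^sup>2 = (x + 1)\<^sup>2" using u[THEN eqD] by Groebner_Basis.algebra
  have "D\<^sup>2 * ?m = - ((x\<^sup>2 + 1) * (x\<^sup>2 - 2 * x - 1)) * (x + 1)\<^sup>2"
    "s\<^sup>2 * ?m = x * (x - 1) ^ 4" "u * ?m = - x * (x - 1) * (x + 1) ^ 3"
    using D[THEN eqD] s2[THEN eqD] u[THEN eqD] by Groebner_Basis.algebra+
  then have "(4 * c) * ?m = (2 * u - s\<^sup>2 - D\<^sup>2) * ?m"
    using c[THEN eqD] by Groebner_Basis.algebra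
  then have c4: "4 * c = 2 * u - s\<^sup>2 - D\<^sup>2" using m by (metis mult_right_cancel)
  have "(D\<^sup>2 * (s\<^sup>2 - 1)) * ?m = - ((x\<^sup>2 + 1) * (x\<^sup>2 - 2 * x - 1)) * ((x - 1)\<^sup>2 - (x + 1)\<^sup>2)"
    using D[THEN eqD] s2[THEN eqD] by Groebner_Basis.algebra
  moreover have "((s - u) * (2 + s + u)) * ?m =
      x * (2 * (x - 1) * (x + 1) * ((x - 1)\<^sup>2 + (x + 1)\<^sup>2) + (x - 1) ^ 4 - (x + 1) ^ 4)"
    using s[THEN eqD] u[THEN eqD] by Groebner_Basis.algebra
  moreover have "- ((x\<^sup>2 + 1) * (x\<^sup>2 - 2 * x - 1)) * ((x - 1)\<^sup>2 - (x + 1)\<^sup>2) =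
      x * (2 * (x - 1) * (x + 1) * ((x - 1)\<^sup>2 + (x + 1)\<^sup>2) + (x - 1) ^ 4 - (x + 1) ^ 4)"
    by Groebner_Basis.algebra
  ultimately have "(D\<^sup>2 * (s\<^sup>2 - 1)) * ?m = ((s - u) * (2 + s + u)) * ?m"
    by (simp only:)
  then have k: "D\<^sup>2 * (s\<^sup>2 - 1) = (s - u) * (2 + s + u)" using m by (metis mult_right_cancel)
  have "4 * ((z 0)\<^sup>2 + c) = 4 * z 1" "4 * ((z 1)\<^sup>2 + c) = 4 * z 2"
    "4 * ((z 2)\<^sup>2 + c) = 4 * z 3" "4 * ((z 3)\<^sup>2 + c) = 4 * z 0"
    using z[THEN eqD] c4[THEN eqD] E[THEN eqD] us[THEN eqD] k[THEN eqD] by Groebner_Basis.algebra+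
  then show ?thesis
    by (simp only: mult_left_cancel[OF zero_neq_numeral[symmetric]])
qed

lemma Y1_8_4_inverse:
  fixes z :: "nat \<Rightarrow> 'k::field_char_0"
  assumes R: "z \<in> extensional {..<8} \<and> (z 0)\<^sup>2 + c = z 1 \<and> (z 1)\<^sup>2 + c = z 2 \<and> (z 2)\<^sup>2 + c = z 3 \<and>
    (z 3)\<^sup>2 + c = z 0 \<and> z 0 \<noteq> z 2 \<and> z 1 \<noteq> z 3 \<and>
    z 0 \<noteq> 0 \<and> z 1 \<noteq> 0 \<and> z 2 \<noteq> 0 \<and> z 3 \<noteq> 0 \<and>
    z 4 = - z 0 \<and> z 5 = - z 1 \<and> z 6 = - z 2 \<and> z 7 = - z 3"
    and x_def: "x = (1 + (z 0 + z 2)) / (1 - (z 0 + z 2))"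
    and y_def: "y = (z 0 - z 2) * x * (x - 1)"
  shows "y\<^sup>2 = X1_form x 1" "y \<noteq> 0" "x \<noteq> 0" "x \<noteq> 1" "x \<noteq> - 1"
    "cycle_point x y 0 = z 0" "cycle_point x y 1 = z 1"
    "cycle_point x y 2 = z 2" "cycle_point x y 3 = z 3"
proof -
  have e: "(z 0)\<^sup>2 + c = z 1" "(z 1)\<^sup>2 + c = z 2" "(z 2)\<^sup>2 + c = z 3" "(z 3)\<^sup>2 + c = z 0"
    and ne: "z 0 \<noteq> z 2" "z 1 \<noteq> z 3" using R by blast+
  define s D u where "s = z 0 + z 2" and "D = z 0 - z 2" and "u = z 1 + z 3"
  have E: "z 1 - z 3 = D * s" unfolding s_def D_def using e[THEN eqD] by Groebner_Basis.algebra
  have zz: "2 * z 0 = s + D" "2 * z 1 = u + D * s" "2 * z 2 = s - D" "2 * z 3 = u - D * s"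
    unfolding E[symmetric] by (simp_all add: s_def D_def u_def)
  have "- D = (z 1 - z 3) * (z 1 + z 3)" unfolding D_def using e[THEN eqD] by Groebner_Basis.algebra
  then have "- D = D * s * u" unfolding E u_def .
  then have "D * - 1 = D * (s * u)" by (simp add: mult.assoc)
  moreover have D0: "D \<noteq> 0" using ne by (simp add: D_def)
  ultimately have su: "s * u = - 1" by (metis mult_left_cancel)
  have "2 * u = 4 * c + s\<^sup>2 + D\<^sup>2" "2 * s = 4 * c + u\<^sup>2 + (D * s)\<^sup>2"
    using e[THEN eqD] unfolding s_def D_def u_def by Groebner_Basis.algebra+
  from this[THEN eqD] have k: "D\<^sup>2 * (s\<^sup>2 - 1) = (s - u) * (2 + s + u)"
    by Groebner_Basis.algebra
  have "s\<^sup>2 * (D\<^sup>2 * (s\<^sup>2 - 1)) = (s\<^sup>2 + 1) * (s\<^sup>2 + 2 * s - 1)"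
    using k[THEN eqD] su[THEN eqD] by Groebner_Basis.algebra
  note k2 = this
  have s0: "s \<noteq> 0" using su by auto
  have s1: "s \<noteq> 1"
  proof
    assume "s = 1"
    with k2 show False by simp
  qed
  have s2: "s \<noteq> - 1"
  proof
    assume "s = - 1"
    with k2 show False by simp
  qed
  have s1': "1 - s \<noteq> 0" using s1 by simp
  have s2': "1 + s \<noteq> 0" using s2 by (auto simp: add_eq_0_iff)
  have x: "x * (1 - s) = 1 + s" using s1' by (simp add: x_def s_def)
  show x0: "x \<noteq> 0" using x s2' by auto
  show x1: "x \<noteq> 1" 
  proof
    assume "x = 1"
    then have "2 * s = 0" using x[THEN eqD] by Groebner_Basis.algebra
    then show False using s0 by simp
  qed
  show x2: "x \<noteq> - 1"
  proof
    assume "x = - 1"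
    then have "(2::'k) = 0" using x[THEN eqD] by Groebner_Basis.algebra
    then show False by simp
  qed
  have nz: "x - 1 \<noteq> 0" "x + 1 \<noteq> 0"
    using x1 x2 by (auto simp: add_eq_0_iff2)
  have y: "y = D * x * (x - 1)" by (simp add: y_def D_def)
  show "y \<noteq> 0" using D0 x0 nz by (simp add: y)
  have sx: "s * (x + 1) = x - 1" using x[THEN eqD] by Groebner_Basis.algebra
  have "(x - 1)\<^sup>2 * (D\<^sup>2 * ((x - 1)\<^sup>2 - (x + 1)\<^sup>2)) =
      ((x - 1)\<^sup>2 + (x + 1)\<^sup>2) * ((x - 1)\<^sup>2 + 2 * (x - 1) * (x + 1) - (x + 1)\<^sup>2)"
    using k2[THEN eqD] sx[THEN eqD] by Groebner_Basis.algebra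
  from this[THEN eqD] have "4 * (D\<^sup>2 * x * (x - 1)\<^sup>2) = 4 * - ((x\<^sup>2 + 1) * (x\<^sup>2 - 2 * x - 1))"
    by Groebner_Basis.algebra
  then have "D\<^sup>2 * x * (x - 1)\<^sup>2 = - ((x\<^sup>2 + 1) * (x\<^sup>2 - 2 * x - 1))"
    by (simp only: mult_left_cancel[OF zero_neq_numeral[symmetric]])
  from this[THEN eqD] have "(D * x * (x - 1))\<^sup>2 = - x * (x\<^sup>2 + 1) * (x\<^sup>2 - 2 * x - 1)"
    by Groebner_Basis.algebra
  then show "y\<^sup>2 = X1_form x 1"
    by (simp add: y X1_form_def)
  have sf: "(x - 1) / (x + 1) = s" using sx nz by (simp add: divide_eq_eq)
  have "u * (x - 1) * s = - (x + 1) * s" using su[THEN eqD] sx[THEN eqD] by Groebner_Basis.algebra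
  then have "u * (x - 1) = - (x + 1)" using s0 by (metis mult_right_cancel)
  then have uf: "- (x + 1) / (x - 1) = u" using nz by (simp only: divide_eq_eq) simp
  have Df: "y / (x * (x - 1)) = D" using x0 nz by (simp add: y)
  have "y = D * s * (x * (x + 1))" using y[THEN eqD] sx[THEN eqD] by Groebner_Basis.algebra
  then have Ef: "y / (x * (x + 1)) = D * s" using x0 nz by simp
  have half: "a / 2 = b" if "a = 2 * b" for a b :: 'k using that by simp
  show "cycle_point x y 0 = z 0" "cycle_point x y 1 = z 1"
    "cycle_point x y 2 = z 2" "cycle_point x y 3 = z 3"
    unfolding cycle_point_nth sf uf Df Ef by (rule half, rule zz[symmetric])+
qed

theorem X1_birational_Y1:
  "bij_betw (\<lambda>(x, y). (marked_parameter x, marking x y))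
     (X1_open :: ('k::field_char_0 \<times> 'k) set) (Y1 portrait_8_4_vertices portrait_8_4_map)"
proof (rule bij_betwI[where g = "\<lambda>(c, z). let s = z 0 + z 2; x = (1 + s) / (1 - s) in
    (x, (z 0 - z 2) * x * (x - 1))"])
  show "(\<lambda>(x, y). (marked_parameter x, marking x y)) \<in>
    (X1_open :: ('k \<times> 'k) set) \<rightarrow> Y1 portrait_8_4_vertices portrait_8_4_map"
  proof (rule funcsetI, clarify)
    fix x y :: 'k assume "(x, y) \<in> X1_open"
    then have y: "y\<^sup>2 = X1_form x 1" and x: "y \<noteq> 0" "x \<noteq> 1" "x \<noteq> - 1"
      and z: "cycle_point x y 0 \<noteq> 0" "cycle_point x y 1 \<noteq> 0"
         "cycle_point x y 2 \<noteq> 0" "cycle_point x y 3 \<noteq> 0"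
      by (auto simp: X1_open_def ball_lt_4)
    have x0: "x \<noteq> 0" using y x by (auto simp: X1_form_def)
    have nz: "x - 1 \<noteq> 0" "x + 1 \<noteq> 0"
      using x by (auto simp: add_eq_0_iff2)
    have half: "(a + b) / 2 \<noteq> (a - b) / 2" if "b \<noteq> 0" for a b :: 'k
    proof
      assume "(a + b) / 2 = (a - b) / 2"
      then have "a + b = a - b" by simp
      then have "b + b = 0" by (simp add: diff_conv_add_uminus eq_neg_iff_add_eq_0 del: add_uminus_conv_diff)
      then have "2 * b = 0" by (simp only: mult_2)
      then show False using that by simp
    qed
    have "cycle_point x y 0 \<noteq> cycle_point x y 2" "cycle_point x y 1 \<noteq> cycle_point x y 3"
      unfolding cycle_point_nth using x x0 nz by (intro half; simp)+
    then show "(marked_parameter x, marking x y) \<in> Y1 portrait_8_4_vertices portrait_8_4_map"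
      unfolding Y1_8_4_iff using cycle_point_equations[OF y x0 x(2,3)] z
      by (simp add: marking_def portrait_8_4_vertices_def)
  qed
next
  show "(\<lambda>(c, z). let s = z 0 + z 2; x = (1 + s) / (1 - s) in (x, (z 0 - z 2) * x * (x - 1))) \<in>
    Y1 portrait_8_4_vertices portrait_8_4_map \<rightarrow> (X1_open :: ('k \<times> 'k) set)"
  proof (rule funcsetI, clarify)
    fix c :: 'k and z assume "(c, z) \<in> Y1 portrait_8_4_vertices portrait_8_4_map"
    note R = this[unfolded Y1_8_4_iff]
    from Y1_8_4_inverse[OF R refl refl]
    show "(let s = z 0 + z 2; x = (1 + s) / (1 - s) in (x, (z 0 - z 2) * x * (x - 1))) \<in> X1_open"
      using R by (auto simp: Let_def X1_open_def ball_lt_4)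
  qed
next
  fix p :: "'k \<times> 'k" assume p: "p \<in> X1_open"
  obtain x y where xy: "p = (x, y)" by fastforce
  from p have y: "y\<^sup>2 = X1_form x 1" and x: "y \<noteq> 0" "x \<noteq> 1" "x \<noteq> - 1"
    by (auto simp: X1_open_def xy)
  have x0: "x \<noteq> 0" using y x by (auto simp: X1_form_def)
  have nz: "x - 1 \<noteq> 0" "x + 1 \<noteq> 0"
    using x by (auto simp: add_eq_0_iff2)
  have two: "(a + b) / 2 + (a - b) / 2 = a" "(a + b) / 2 - (a - b) / 2 = b" for a b :: 'k
    by (simp_all add: field_simps)
  have m: "marking x y 0 + marking x y 2 = (x - 1) / (x + 1)"
    "marking x y 0 - marking x y 2 = y / (x * (x - 1))"
    by (simp_all add: marking_def portrait_8_4_vertices_def cycle_point_nth two)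
  have "1 + (x - 1) / (x + 1) = 2 * x / (x + 1)" "1 - (x - 1) / (x + 1) = 2 / (x + 1)"
    using nz by (simp_all add: field_simps)
  then have "(1 + (x - 1) / (x + 1)) / (1 - (x - 1) / (x + 1)) = x"
    using nz by simp
  then show "(case case p of (x, y) \<Rightarrow> (marked_parameter x, marking x y) of
    (c, z) \<Rightarrow> let s = z 0 + z 2; x = (1 + s) / (1 - s) in (x, (z 0 - z 2) * x * (x - 1))) = p"
    using x0 nz by (simp only: xy m Let_def prod.case) simp
next
  fix q :: "'k \<times> (nat \<Rightarrow> 'k)" assume q: "q \<in> Y1 portrait_8_4_vertices portrait_8_4_map"
  obtain c z where cz: "q = (c, z)" by fastforce
  note R = q[unfolded cz Y1_8_4_iff]
  define x where "x = (1 + (z 0 + z 2)) / (1 - (z 0 + z 2))"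
  define y where "y = (z 0 - z 2) * x * (x - 1)"
  note I = Y1_8_4_inverse[OF R x_def y_def]
  have "marking x y = z"
  proof
    fix i
    have "\<forall>i<8. marking x y i = z i"
      unfolding ball_lt_8 marking_def portrait_8_4_vertices_def using R I by simp
    then show "marking x y i = z i"
    proof (cases "i < 8")
      case True
      with \<open>\<forall>i<8. marking x y i = z i\<close> show ?thesis by blast
    next
      case False
      then show ?thesis using R by (simp add: marking_def portrait_8_4_vertices_def extensional_def)
    qed
  qed
  moreover have "marked_parameter x = c"
    using cycle_point_equations[of y x] I R by (metis add_left_cancel)
  ultimately show "(case case q of (c, z) \<Rightarrow> let s = z 0 + z 2; x = (1 + s) / (1 - s) in
      (x, (z 0 - z 2) * x * (x - 1)) of (x, y) \<Rightarrow> (marked_parameter x, marking x y)) = q"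
    by (simp only: cz Let_def prod.case x_def[symmetric] y_def[symmetric])
qed

end

theory Submission
  imports Defs
begin

text \<open>
  For integers \<open>s = l\<^sup>2 t\<close> the point of \<open>X1\<close> with \<open>x = s\<close> is defined over the field of the square root of
  \<open>d = - t (s\<^sup>2 + 1) (s\<^sup>2 - 2 s - 1)\<close>, and \<open>d \<equiv> t\<close> modulo every divisor of \<open>l\<close>. An elementary sieve
  makes the three factors squarefree for infinitely many \<open>t\<close> in a given residue class: they have degree at most 2,
  so a prime whose square divides one of them is \<open>O(t)\<close>, and the primes have density 0.

  For the class number take \<open>t \<equiv> 2\<close> modulo 4, so that the ring of integers is \<open>\<int>[\<surd>d]\<close>, and put
  \<open>a = t (s\<^sup>2 + 1)\<close>, \<open>b = s\<^sup>2 - 2 s - 1\<close>, \<open>d = - a b\<close>. The ideal \<open>(a, \<surd>d)\<close> has order 2 in the class group.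
  The 5-torsion of the Jacobian appears as the identity
  \<open>(s - 1)\<^sup>5 = s (s\<^sup>2 + 1) (s - 3)\<^sup>2 + (s\<^sup>2 - 2 s - 1) (s + 1)\<^sup>2\<close>: it yields an element \<open>\<beta>\<close> of norm \<open>(s - 1)\<^sup>1\<^sup>0\<close>,
  and the ideal \<open>((s - 1)\<^sup>2, \<beta>)\<close>, whose fifth power is \<open>(\<beta>)\<close>, has norm \<open>(s - 1)\<^sup>2 < \<bar>d\<bar>\<close> and is not principal.
\<close>

section \<open>Density of the primes\<close>

lemma prod_primes_dvd:
  fixes m :: nat
  assumes "finite A" "\<And>p. p \<in> A \<Longrightarrow> prime p \<and> p dvd m"
  shows "\<Prod>A dvd m"
  using assms
proof (induction A)
  case (insert x F)
  have "coprime x (\<Prod>F)"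
    using insert by (intro prod_coprime_right) (auto intro!: primes_coprime)
  with insert show ?case by (auto intro!: divides_mult)
qed auto

text \<open>Chebyshev's argument: with n = 2^j, every prime in (n, 2n] divides the central binomial
  coefficient, which is at most 4^n, so passing from n to 2n squares the bound.\<close>

lemma prod_primes_le: "\<Prod>{p::nat. prime p \<and> p \<le> 2 ^ j} \<le> 4 ^ 2 ^ j"
proof (induction j)
  case 0
  have "{p::nat. prime p \<and> p \<le> 2 ^ 0} = {}"
    by (auto dest: prime_gt_1_nat)
  then show ?case by (simp only: prod.empty) simp
next
  case (Suc j)
  define n :: nat where "n = 2 ^ j"
  define A where "A = {p. prime p \<and> p \<le> n}"
  define B where "B = {p. prime p \<and> n < p \<and> p \<le> 2 * n}"
  have fin: "finite A" "finite B" by (auto simp: A_def B_def)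
  have "\<Prod>B dvd (2 * n choose n)"
  proof -
    have "p dvd (2 * n choose n)" if "p \<in> B" for p
    proof -
      have p: "prime p" "n < p" "p \<le> 2 * n" using that by (auto simp: B_def)
      have "fact n * fact (2 * n - n) * (2 * n choose n) = (fact (2 * n) :: nat)"
        by (rule binomial_fact_lemma) simp
      then have "p dvd fact n * fact n * (2 * n choose n)"
        using p by (simp add: prime_dvd_fact_iff)
      then show ?thesis using p by (auto simp: prime_dvd_mult_iff prime_dvd_fact_iff)
    qed
    then show ?thesis using fin(2) by (auto intro!: prod_primes_dvd simp: B_def)
  qed
  then have "\<Prod>B \<le> (2 * n choose n)" by (intro dvd_imp_le) auto
  also have "\<dots> \<le> 2 ^ (2 * n)" by (rule binomial_le_pow2)
  also have "\<dots> = 4 ^ n" by (simp add: power_mult)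
  finally have "\<Prod>B \<le> 4 ^ n" .
  moreover have "\<Prod>{p::nat. prime p \<and> p \<le> 2 ^ Suc j} = \<Prod>A * \<Prod>B"
  proof -
    have "{p::nat. prime p \<and> p \<le> 2 ^ Suc j} = A \<union> B" by (auto simp: A_def B_def n_def)
    then show ?thesis using fin by (simp add: prod.union_disjoint A_def B_def disjoint_iff)
  qed
  moreover have "\<Prod>A \<le> 4 ^ n"
    using Suc.IH by (simp only: A_def n_def)
  ultimately have "\<Prod>{p::nat. prime p \<and> p \<le> 2 ^ Suc j} \<le> 4 ^ n * 4 ^ n"
    by (simp only: mult_le_mono)
  also have "\<dots> = 4 ^ 2 ^ Suc j"
    by (simp only: n_def power_add[symmetric] mult_2[symmetric] power_Suc)
  finally show ?case .
qed

text \<open>A weak form of pi(x) = O(x / log x) at x = 4^i. Primes up to 2^i are counted trivially;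
  each larger one contributes a factor of at least 2^i to the product of primes, which is at most
  4^(4^i).\<close>

lemma card_primes_le: "i * card {p::nat. prime p \<and> p \<le> 4 ^ i} \<le> 3 * 4 ^ i"
proof -
  define A where "A = {p::nat. prime p \<and> p \<le> 2 ^ i}"
  define B where "B = {p::nat. prime p \<and> 2 ^ i < p \<and> p \<le> 4 ^ i}"
  have fin: "finite A" "finite B" by (auto simp: A_def B_def)
  have four: "(4::nat) ^ i = 2 ^ (2 * i)" by (simp add: power_mult)
  have "(2::nat) ^ i \<le> 4 ^ i" by (rule power_mono) auto
  then have AB: "{p::nat. prime p \<and> p \<le> 4 ^ i} = A \<union> B"
    by (auto simp: A_def B_def simp del: power_increasing_iff power_mono_iff)
  have "2 ^ (i * card B) = (\<Prod>p\<in>B. 2 ^ i :: nat)" by (simp add: power_mult)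
  also have "\<dots> \<le> \<Prod>B" by (rule prod_mono) (auto simp: B_def)
  also have "\<dots> \<le> \<Prod>{p. prime p \<and> p \<le> 2 ^ (2 * i)}"
    by (rule dvd_imp_le[OF prod_dvd_prod_subset]) (auto simp: B_def four intro!: prod_pos prime_gt_0_nat)
  also have "\<dots> \<le> 4 ^ 2 ^ (2 * i)" by (rule prod_primes_le)
  also have "\<dots> = 2 ^ (2 * 4 ^ i)" by (simp add: power_mult)
  finally have B: "i * card B \<le> 2 * 4 ^ i" by simp
  have "card A \<le> card {1..2 ^ i :: nat}" 
    by (rule card_mono) (auto simp: A_def Suc_le_eq prime_gt_0_nat)
  then have "i * card A \<le> 2 ^ i * 2 ^ i" by (intro mult_le_mono) (auto simp: less_imp_le)
  then have "i * card A \<le> 4 ^ i" by (simp add: power_mult_distrib[symmetric])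
  moreover have "i * card (A \<union> B) \<le> i * card A + i * card B"
    by (metis add_mult_distrib2 card_Un_le mult_le_mono2)
  ultimately show ?thesis using B unfolding AB by simp
qed

section \<open>Squarefree values\<close>

text \<open>Members of one residue class are separated by their quotients by m.\<close>

lemma card_cong_class_le:
  fixes S :: "nat set"
  assumes "S \<subseteq> {..<K}" "\<And>x y. x \<in> S \<Longrightarrow> y \<in> S \<Longrightarrow> [x = y] (mod m)"
  shows "card S \<le> K div m + 1"
proof -
  have "inj_on (\<lambda>k. k div m) S"
    using assms(2) by (intro inj_onI) (metis cong_def div_mult_mod_eq)
  then have "card S = card ((\<lambda>k. k div m) ` S)" by (simp add: card_image)
  also have "\<dots> \<le> card {..K div m}"
    using assms(1) by (intro card_mono) (auto intro!: div_le_mono)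
  finally show ?thesis by simp
qed

text \<open>Meant for M = q^2 and w x a square root of a fixed unit modulo M: all values agree up to
  sign with that of one chosen element, which leaves two residue classes modulo m.\<close>

lemma card_cong_two_classes_le:
  fixes S :: "nat set" and w :: "nat \<Rightarrow> int"
  assumes "S \<subseteq> {..<K}" 
    and two: "\<And>x y. x \<in> S \<Longrightarrow> y \<in> S \<Longrightarrow> [w x = w y] (mod M) \<or> [w x = - w y] (mod M)"
    and inj: "\<And>x y. [w x = w y] (mod M) \<Longrightarrow> [x = y] (mod m)"
  shows "card S \<le> 2 * (K div m + 1)"
proof (cases "S = {}")
  case False
  then obtain z where z: "z \<in> S" by blast
  define A where "A = {x \<in> S. [w x = w z] (mod M)}"
  define B where "B = {x \<in> S. [w x = - w z] (mod M)}"
  have "S \<subseteq> A \<union> B" using two[OF _ z] by (auto simp: A_def B_def)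
  moreover have "finite S" using assms(1) finite_subset by blast
  ultimately have "card S \<le> card A + card B"
    by (metis (no_types, lifting) A_def B_def card_Un_le card_mono finite_UnI finite_subset le_trans
        mem_Collect_eq subsetI)
  moreover have "card A \<le> K div m + 1"
    by (rule card_cong_class_le) (use assms(1) in \<open>auto simp: A_def intro!: inj intro: cong_trans cong_sym\<close>)
  moreover have "card B \<le> K div m + 1"
    by (rule card_cong_class_le) (use assms(1) in \<open>auto simp: B_def intro!: inj intro: cong_trans cong_sym\<close>)
  ultimately show ?thesis by simp
qed auto

lemma sum_inverse_squares_le:
  assumes "0 < a"
  shows "(\<Sum>n\<in>{a<..b}. 1 / (real n)\<^sup>2) \<le> 1 / real a"
proof (cases "a \<le> b")
  case True
  \<comment> \<open>Subtracting the telescoped end 1 / b makes the bound inductive.\<close>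
  then have "(\<Sum>n\<in>{a<..b}. 1 / (real n)\<^sup>2) \<le> 1 / real a - 1 / real b"
  proof (induction rule: dec_induct)
    case (step b)
    have "{a<..Suc b} = insert (Suc b) {a<..b}" using step by auto
    moreover have "1 / (real (Suc b))\<^sup>2 \<le> 1 / real b - 1 / real (Suc b)"
    proof -
      have "1 / (real (Suc b))\<^sup>2 \<le> 1 / (real b * real (Suc b))"
        using assms step by (intro divide_left_mono) (auto simp: power2_eq_square)
      also have "\<dots> = 1 / real b - 1 / real (Suc b)"
        using assms step by (simp add: field_simps)
      finally show ?thesis .
    qed
    ultimately show ?case using step.IH by simp
  qed simp
  then show ?thesis by (smt (verit) divide_nonneg_nonneg of_nat_0_le_iff)
qed simp

text \<open>
  The density of the union is at most \<open>\<Sum>\<^sub>q 1 / q\<^sup>2\<close> over all primes plus four times the sum over \<open>q > 20\<close>, which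
  is less than 1; the error terms amount to five times the number of primes up to a multiple of \<open>K\<close>.
\<close>

lemma exists_not_in_sparse_sets:
  fixes bad :: "nat \<Rightarrow> nat set"
  assumes range: "\<And>q k. prime q \<Longrightarrow> k \<in> bad q \<Longrightarrow> q \<le> C * (k + 1)"
    and small: "\<And>q K. prime q \<Longrightarrow> q \<le> 20 \<Longrightarrow> card (bad q \<inter> {..<K}) \<le> K div q\<^sup>2 + 1"
    and large: "\<And>q K. prime q \<Longrightarrow> 20 < q \<Longrightarrow> card (bad q \<inter> {..<K}) \<le> 5 * (K div q\<^sup>2 + 1)"
  shows "\<exists>k. \<forall>q. prime q \<longrightarrow> k \<notin> bad q"
proof -
  \<comment> \<open>\<open>X\<close> bounds every prime q that is bad for some k < K. The factor 150
    = 3 * 50 makes the Chebyshev bound 3 * 4^C * K at most i * K / 50, so that \<open>P\<close> has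
    at most K / 50 elements.\<close>
  define i :: nat where "i = 150 * 4 ^ C + 1"
  define K :: nat where "K = 4 ^ i"
  define X :: nat where "X = 4 ^ (C + i)"
  define P where "P = {q. prime q \<and> q \<le> X}"
  have fin: "finite P" by (simp add: P_def)
  have XK: "X = 4 ^ C * K" by (simp add: X_def K_def power_add)
  have "K > 0" by (simp add: K_def)
  have "C \<le> 4 ^ C" by (rule less_imp_le[OF power_gt_expt]) simp
  have cover: "k \<in> (\<Union>q\<in>P. bad q \<inter> {..<K})" if "k < K" "prime q" "k \<in> bad q" for k q
  proof -
    have "q \<le> C * (k + 1)" using range that by blast
    also have "\<dots> \<le> 4 ^ C * K" using \<open>C \<le> 4 ^ C\<close> that(1) by (intro mult_le_mono) auto
    finally show ?thesis using that by (auto simp: P_def XK)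
  qed
  define w :: "nat \<Rightarrow> real" where "w q = (if q \<le> 20 then 1 else 5)" for q
  have card_bad: "real (card (bad q \<inter> {..<K})) \<le> real K * (w q / (real q)\<^sup>2) + 5" if "q \<in> P" for q
  proof -
    have "card (bad q \<inter> {..<K}) \<le> (if q \<le> 20 then 1 else 5) * (K div q\<^sup>2 + 1)"
      using small[of q K] large[of q K] that unfolding P_def by (cases "q \<le> 20") simp_all
    then have "real (card (bad q \<inter> {..<K})) \<le> real ((if q \<le> 20 then 1 else 5) * (K div q\<^sup>2 + 1))"
      by (rule of_nat_mono)
    also have "\<dots> = w q * real (K div q\<^sup>2 + 1)"
      by (simp add: w_def)
    also have "\<dots> \<le> w q * (real K / (real q)\<^sup>2 + 1)"
      using of_nat_div_le_of_nat[of K "q\<^sup>2", where 'a = real] by (intro mult_left_mono) (auto simp: w_def)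
    also have "\<dots> \<le> real K * (w q / (real q)\<^sup>2) + 5" by (simp add: w_def algebra_simps)
    finally show ?thesis .
  qed
  \<comment> \<open>The pieces add up to 1/4 + 1/9 + 1/4 + 1/4 < 87/100; leaving out the composite 4
    is what lets the first tail start after 4.\<close>
  have w_sum: "(\<Sum>q\<in>P. w q / (real q)\<^sup>2) \<le> 87 / 100"
  proof -
    let ?g = "\<lambda>n. w n / (real n)\<^sup>2"
    have "q \<in> {2, 3} \<union> {4<..20} \<union> {20<..X}" if "q \<in> P" for q
    proof -
      have "prime q" "q \<le> X" using that by (auto simp: P_def)
      moreover have "\<not> prime (4::nat)" using prime_product[of 2 2] by auto
      ultimately show ?thesis using prime_ge_2_nat[of q]
        by (cases "q = 4") auto
    qed
    then have "P \<subseteq> {2, 3} \<union> {4<..20} \<union> {20<..X}" by blast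
    then have "sum ?g P \<le> sum ?g ({2, 3} \<union> {4<..20} \<union> {20<..X})"
      by (rule sum_mono2[rotated]) (simp_all add: w_def)
    also have "\<dots> = sum ?g {2, 3} + sum ?g {4<..20} + sum ?g {20<..X}"
      by (subst sum.union_disjoint; (subst sum.union_disjoint)?) auto
    also have "sum ?g {2, 3} = 1 / 4 + 1 / 9" by (simp add: w_def)
    also have "sum ?g {4<..20} = (\<Sum>n\<in>{4<..20}. 1 / (real n)\<^sup>2)"
      by (intro sum.cong) (auto simp: w_def)
    also have "\<dots> \<le> 1 / 4" using sum_inverse_squares_le[of 4 20] by simp
    also have "sum ?g {20<..X} = 5 * (\<Sum>n\<in>{20<..X}. 1 / (real n)\<^sup>2)"
      unfolding sum_distrib_left by (intro sum.cong) (auto simp: w_def)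
    also have "\<dots> \<le> 5 * (1 / 20)" using sum_inverse_squares_le[of 20 X] by simp
    finally show ?thesis by simp
  qed
  have "real i * real (card P) \<le> real (C + i) * real (card P)" by (intro mult_right_mono) auto
  also have "\<dots> \<le> 3 * real X"
    using of_nat_mono[OF card_primes_le[of "C + i"], where 'a = real]
    by (simp only: P_def X_def of_nat_mult of_nat_numeral)
  also have "\<dots> \<le> (real i / 50) * real K"
    unfolding XK i_def by (simp add: distrib_right)
  finally have "real i * real (card P) \<le> real i * (real K / 50)" by simp
  then have cardP: "real (card P) \<le> real K / 50"
    by (rule mult_left_le_imp_le) (simp add: i_def add_pos_nonneg)
  have "real (card (\<Union>q\<in>P. bad q \<inter> {..<K})) \<le> (\<Sum>q\<in>P. real (card (bad q \<inter> {..<K})))"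
    using of_nat_mono[OF card_UN_le[OF fin], where 'a = real] by (simp only: of_nat_sum)
  also have "\<dots> \<le> (\<Sum>q\<in>P. real K * (w q / (real q)\<^sup>2) + 5)"
    by (intro sum_mono card_bad)
  also have "\<dots> = real K * (\<Sum>q\<in>P. w q / (real q)\<^sup>2) + 5 * real (card P)"
    by (simp add: sum.distrib sum_distrib_left)
  \<comment> \<open>The error of 5 per prime adds at most 1/10, so the bad fraction is at most
    97/100.\<close>
  also have "\<dots> \<le> real K * (87 / 100) + 5 * (real K / 50)"
    using w_sum cardP by (intro add_mono mult_left_mono) auto
  also have "\<dots> < real K" using \<open>K > 0\<close> by simp
  finally have "card (\<Union>q\<in>P. bad q \<inter> {..<K}) < card {..<K}" by simp
  then have "\<not> {..<K} \<subseteq> (\<Union>q\<in>P. bad q \<inter> {..<K})"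
    using fin by (metis card_mono finite_Int finite_UN finite_lessThan linorder_not_less)
  then show ?thesis using cover by blast
qed

text \<open>Q will be a square l^2, so that Q * t is the x-coordinate s; the three numbers are the
  factors of \<open>- disc Q t\<close>.\<close>

definition admissible :: "nat \<Rightarrow> nat \<Rightarrow> bool" where
  "admissible Q t \<longleftrightarrow> squarefree (int t) \<and> squarefree ((int (Q * t))\<^sup>2 + 1) \<and>
     squarefree ((int (Q * t))\<^sup>2 - 2 * int (Q * t) - 1)"

lemma squarefree_intI:
  fixes n :: int
  assumes "n \<noteq> 0" "\<And>q::nat. prime q \<Longrightarrow> \<not> (int q)\<^sup>2 dvd n"
  shows "squarefree n"
proof -
  have "\<not> q\<^sup>2 dvd n" if "prime q" for q :: int
  proof -
    have "q = int (nat q)" "prime (nat q)" using that by (auto simp: prime_ge_0_int prime_nat_iff_prime)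
    then show ?thesis using assms(2)[of "nat q"] by simp
  qed
  then show ?thesis using assms(1) by (subst squarefree_factorial_semiring) auto
qed

text \<open>A prime q dividing Q, in particular q <= 20 or q = p, divides neither quadratic factor,
  as these are 1 or -1 modulo q. At p the choice of r keeps p^2 from dividing t. For q other than p,
  the factor t excludes at most one class of k modulo q^2, and for q > 20 each quadratic factor at
  most two, hence 1 + 2 + 2 = 5.\<close>

lemma exists_admissible:
  fixes p r Q :: nat
  assumes p: "prime p" "\<not> p\<^sup>2 dvd r" and Q: "fact 20 * p dvd Q" "Q > 0"
  shows "\<exists>k. admissible Q (r + p\<^sup>2 * k)"
proof -
  define t where "t k = r + p\<^sup>2 * k" for k
  have r: "r > 0" using p by (cases r) auto
  define s where "s k = int (Q * t k)" for k
  \<comment> \<open>Completing the square puts both quadratic factors in the form w^2 - e with e =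
    -1 or e = 2, so q^2 divides one exactly when w is a square root of e modulo q^2.\<close>
  define f where "f e k = (s k - (if e = 2 then 1 else 0))\<^sup>2 - e" for e :: int and k
  have fe: "f (-1) k = (s k)\<^sup>2 + 1" "f 2 k = (s k)\<^sup>2 - 2 * s k - 1" for k
    by (simp_all add: f_def power2_eq_square algebra_simps)
  have s: "3 \<le> s k" for k
  proof -
    have "fact 20 \<le> Q" using Q p by (intro dvd_imp_le) (auto dest: dvd_mult_left)
    moreover have "3 \<le> (fact 20 :: nat)" using fact_ge_self[of 20] by linarith
    moreover have "1 \<le> t k" using r by (simp add: t_def)
    ultimately have "3 * 1 \<le> Q * t k" by (intro mult_le_mono) linarith+
    then show ?thesis unfolding s_def by linarith
  qed
  have fpos: "0 < f e k" "f e k < (s k + 1)\<^sup>2" if "e \<in> {-1, 2}" for e k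
  proof -
    have "3 * s k \<le> (s k)\<^sup>2"
      unfolding power2_eq_square using s[of k] by (intro mult_right_mono) linarith+
    then have "0 < f (-1) k" "0 < f 2 k" "f (-1) k < (s k + 1)\<^sup>2" "f 2 k < (s k + 1)\<^sup>2"
      using s[of k] by (simp_all add: fe power2_sum)
    then show "0 < f e k" "f e k < (s k + 1)\<^sup>2" using that by auto
  qed
  have not_dvd: "\<not> int q dvd f e k" if "prime q" "q dvd Q" "e \<in> {-1, 2}" for q e k
  proof
    assume *: "int q dvd f e k"
    have sq: "int q dvd s k" using that unfolding s_def by (simp only: of_nat_dvd_iff dvd_mult2)
    have "int q dvd s k * s k - f e k - 2 * s k" "int q dvd s k * s k - f e k"
      using * sq by (auto intro: dvd_diff dvd_mult)
    then have "int q dvd 1" using that(3) by (auto simp: fe power2_eq_square)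
    then show False using that(1) by auto
  qed
  define Bt where "Bt q = {k. q\<^sup>2 dvd t k}" for q
  define B where "B e q = {k. (int q)\<^sup>2 dvd f e k}" for e q
  define bad where "bad q = Bt q \<union> B (-1) q \<union> B 2 q" for q
  have small_dvd: "q dvd Q" if "prime q" "q \<le> 20" for q
    using that Q(1) prime_dvd_fact_iff[of q 20] by (meson dvd_trans dvd_triv_left)
  \<comment> \<open>p^2 is a unit modulo q^2, so t k determines k there.\<close>
  have tcong: "[k = l] (mod q\<^sup>2)" if "prime q" "q \<noteq> p" "[t k = t l] (mod q\<^sup>2)" for q k l
  proof -
    have "coprime (p\<^sup>2) (q\<^sup>2)" using that p by (simp add: primes_coprime)
    moreover have "[p\<^sup>2 * k = p\<^sup>2 * l] (mod q\<^sup>2)"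
      using that(3) unfolding t_def by (simp only: cong_add_lcancel_nat)
    ultimately show ?thesis using cong_mult_lcancel_nat by blast
  qed
  have Bt: "card (Bt q \<inter> {..<K}) \<le> K div q\<^sup>2 + 1" if "prime q" for q K
  proof (cases "q = p")
    case True
    then have "Bt q = {}" using p by (auto simp: Bt_def t_def dvd_add_left_iff)
    then show ?thesis by simp
  next
    case False
    show ?thesis
    proof (rule card_cong_class_le)
      fix x y assume "x \<in> Bt q \<inter> {..<K}" "y \<in> Bt q \<inter> {..<K}"
      then have "[t x = t y] (mod q\<^sup>2)" by (simp add: Bt_def cong_def)
      then show "[x = y] (mod q\<^sup>2)" using tcong that False by blast
    qed auto
  qed
  have B_dvd: "B e q = {}" if "prime q" "q dvd Q" "e \<in> {-1, 2}" for q e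
    using not_dvd[OF that] unfolding B_def power2_eq_square by (blast dest: dvd_mult_left)
  have B: "card (B e q \<inter> {..<K}) \<le> 2 * (K div q\<^sup>2 + 1)" if q: "prime q" "20 < q" and e: "e \<in> {-1, 2}" for q e K
  proof (cases "q dvd Q")
    case True
    then show ?thesis using B_dvd q e by simp
  next
    case False
    define w where "w k = s k - (if e = 2 then 1 else 0)" for k
    have fw: "f e k = (w k)\<^sup>2 - e" for k by (simp add: f_def w_def)
    have pq: "prime (int q)" using q by simp
    \<comment> \<open>The absolute value of 2 e is at most 4 < q, so 2 and e are units modulo q and
      the roots w and -w stay distinct.\<close>
    have q2e: "\<not> int q dvd 2 * e"
    proof
      assume "int q dvd 2 * e"
      then have "\<bar>int q\<bar> \<le> \<bar>2 * e\<bar>" using e by (intro dvd_imp_le_int) auto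
      then show False using q e by auto
    qed
    show ?thesis
    proof (rule card_cong_two_classes_le[where w = w and M = "(int q)\<^sup>2"])
      fix x y assume "x \<in> B e q \<inter> {..<K}" "y \<in> B e q \<inter> {..<K}"
      then have dv: "(int q)\<^sup>2 dvd (w x)\<^sup>2 - e" "(int q)\<^sup>2 dvd (w y)\<^sup>2 - e" by (auto simp: B_def fw)
      have "(int q)\<^sup>2 dvd ((w x)\<^sup>2 - e) - ((w y)\<^sup>2 - e)" using dv by (rule dvd_diff)
      also have "\<dots> = (w x - w y) * (w x + w y)" by (simp add: power2_eq_square algebra_simps)
      finally have prod: "(int q)\<^sup>2 dvd (w x - w y) * (w x + w y)" .
      \<comment> \<open>If q divided both factors it would divide 2 w^2 and 2 (w^2 - e), hence 2 e.
        So the whole of q^2 divides one of them.\<close>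
      have "\<not> (int q dvd w x - w y \<and> int q dvd w x + w y)"
      proof
        assume "int q dvd w x - w y \<and> int q dvd w x + w y"
        then have "int q dvd (w x - w y) + (w x + w y)" by (blast intro: dvd_add)
        then have "int q dvd 2 * w x * w x" by simp
        moreover have "int q dvd 2 * ((w x)\<^sup>2 - e)" using dv(1) unfolding power2_eq_square[of "int q"] by (intro dvd_mult) (rule dvd_mult_left)
        ultimately have "int q dvd 2 * w x * w x - 2 * ((w x)\<^sup>2 - e)" by (rule dvd_diff)
        then show False using q2e by (simp add: power2_eq_square algebra_simps)
      qed
      then consider "coprime ((int q)\<^sup>2) (w x - w y)" | "coprime ((int q)\<^sup>2) (w x + w y)"
        using pq by (auto simp: prime_imp_coprime)
      then show "[w x = w y] (mod (int q)\<^sup>2) \<or> [w x = - w y] (mod (int q)\<^sup>2)"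
        using prod by cases (auto simp: cong_iff_dvd_diff coprime_dvd_mult_left_iff coprime_dvd_mult_right_iff)
    next
      fix x y assume "[w x = w y] (mod (int q)\<^sup>2)"
      then have "[int (Q * t x) = int (Q * t y)] (mod int (q\<^sup>2))"
        by (simp only: w_def s_def cong_iff_dvd_diff diff_diff_eq2 diff_add_cancel of_nat_power)
      then have "[Q * t x = Q * t y] (mod q\<^sup>2)" by (simp only: cong_int_iff)
      moreover have "coprime Q (q\<^sup>2)" using False q
        using prime_imp_coprime[of q Q] by (simp add: coprime_commute)
      ultimately have "[t x = t y] (mod q\<^sup>2)" using cong_mult_lcancel_nat by blast
      moreover have "q \<noteq> p" using False Q(1) by (auto dest: dvd_mult_right)
      ultimately show "[x = y] (mod q\<^sup>2)" using tcong q by blast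
    qed auto
  qed
  have "\<exists>k. \<forall>q. prime q \<longrightarrow> k \<notin> bad q"
  proof (rule exists_not_in_sparse_sets)
    fix q k assume q: "prime q" "k \<in> bad q"
    have "t k \<le> (r + p\<^sup>2) * (k + 1)" by (simp add: t_def algebra_simps)
    then have *: "Q * t k + 1 \<le> (Q * (r + p\<^sup>2) + 1) * (k + 1)"
      using mult_le_mono2[of "t k" "(r + p\<^sup>2) * (k + 1)" Q] by (simp add: algebra_simps)
    \<comment> \<open>If q^2 divides a positive number below (s + 1)^2 then q <= s, which is linear
      in k although the quadratic factors are not.\<close>
    have "q \<le> Q * t k + 1"
    proof (cases "k \<in> Bt q")
      case True
      then have "q\<^sup>2 \<le> t k" using r by (intro dvd_imp_le) (auto simp: Bt_def t_def)
      then have "q \<le> t k" using power2_nat_le_imp_le by blast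
      also have "t k \<le> Q * t k" using Q(2) by simp
      finally show ?thesis by simp
    next
      case False
      then obtain e where e: "e \<in> {-1, 2}" "(int q)\<^sup>2 dvd f e k" using q by (auto simp: bad_def B_def)
      have "(int q)\<^sup>2 \<le> f e k" using e fpos by (intro zdvd_imp_le) auto
      also have "\<dots> < (s k + 1)\<^sup>2" using fpos e by blast
      finally have "int q < s k + 1" by (rule power_less_imp_less_base) (use s[of k] in linarith)
      then show ?thesis unfolding s_def by linarith
    qed
    with * show "q \<le> (Q * (r + p\<^sup>2) + 1) * (k + 1)" by linarith
  next
    fix q K :: nat assume "prime q" "q \<le> 20"
    then have "bad q = Bt q" using B_dvd small_dvd by (simp add: bad_def)
    then show "card (bad q \<inter> {..<K}) \<le> K div q\<^sup>2 + 1" using Bt \<open>prime q\<close> by simp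
  next
    fix q K :: nat assume q: "prime q" "20 < q"
    have "bad q \<inter> {..<K} = Bt q \<inter> {..<K} \<union> B (-1) q \<inter> {..<K} \<union> B 2 q \<inter> {..<K}"
      by (auto simp: bad_def)
    then have "card (bad q \<inter> {..<K}) \<le> card (Bt q \<inter> {..<K}) + card (B (-1) q \<inter> {..<K}) + card (B 2 q \<inter> {..<K})"
      using order.trans[OF card_Un_le add_right_mono[OF card_Un_le]] by simp
    also have "\<dots> \<le> 5 * (K div q\<^sup>2 + 1)"
      using Bt[OF q(1), of K] B[OF q, of "-1" K] B[OF q, of 2 K] by simp
    finally show "card (bad q \<inter> {..<K}) \<le> 5 * (K div q\<^sup>2 + 1)" .
  qed
  then obtain k where k: "\<And>q. prime q \<Longrightarrow> k \<notin> bad q" by blast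
  have "squarefree (int (t k))"
  proof (rule squarefree_intI)
    have "t k > 0" using r by (simp add: t_def)
    then show "int (t k) \<noteq> 0" by simp
    show "\<not> (int q)\<^sup>2 dvd int (t k)" if "prime q" for q
      using k[OF that] by (simp add: bad_def Bt_def flip: of_nat_power)
  qed
  moreover have "squarefree (f e k)" if e: "e \<in> {-1, 2}" for e
    by (rule squarefree_intI) (use k e fpos(1)[OF e, of k] in \<open>auto simp: bad_def B_def\<close>)
  ultimately show ?thesis unfolding admissible_def t_def[symmetric] s_def[symmetric] fe[symmetric] by blast
qed

section \<open>Quadratic fields and points\<close>

lemma complex_field_simps [simp]:
  "carrier complex_field = UNIV" "monoid.mult complex_field = (*)" "one complex_field = 1"
  "zero complex_field = 0" "add complex_field = (+)"
  by (simp_all add: complex_field_def)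

lemma field_complex_field: "field complex_field"
proof (rule cring.cring_fieldI2)
  show "cring complex_field"
  proof (rule cringI)
    show "abelian_group complex_field"
      by (rule abelian_groupI) (auto simp: algebra_simps intro: exI[of _ "- x" for x])
    show "comm_monoid complex_field"
      by (rule comm_monoidI) auto
  qed (auto simp: algebra_simps)
next
  fix a assume "a \<noteq> \<zero>\<^bsub>complex_field\<^esub>"
  then show "\<exists>b\<in>carrier complex_field. a \<otimes>\<^bsub>complex_field\<^esub> b = \<one>\<^bsub>complex_field\<^esub>"
    by (auto intro!: exI[of _ "inverse a"])
qed auto

interpretation CF: cring complex_field
  rewrites "carrier complex_field = UNIV" and "monoid.mult complex_field = (*)"
    and "one complex_field = 1" and "zero complex_field = 0" and "add complex_field = (+)"
  by (rule domain.axioms(1)[OF field.axioms(1)[OF field_complex_field]]) simp_all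

lemma complex_field_a_inv [simp]: "\<ominus>\<^bsub>complex_field\<^esub> x = - x"
  using CF.minus_equality[of "- x" x] by simp

lemma complex_field_m_inv: "x \<noteq> 0 \<Longrightarrow> inv\<^bsub>complex_field\<^esub> x = inverse x"
  using CF.comm_inv_char[of x "inverse x"] by simp

lemma subfield_complex_fieldD:
  assumes "subfield L complex_field"
  shows "0 \<in> L" "1 \<in> L" "\<And>x y. x \<in> L \<Longrightarrow> y \<in> L \<Longrightarrow> x + y \<in> L"
    "\<And>x y. x \<in> L \<Longrightarrow> y \<in> L \<Longrightarrow> x * y \<in> L" "\<And>x. x \<in> L \<Longrightarrow> - x \<in> L"
    "\<And>x. x \<in> L \<Longrightarrow> inverse x \<in> L"
proof -
  note s = subringE[OF subfieldE(1)[OF assms]]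
  show "0 \<in> L" "1 \<in> L" using s(2,3) by auto
  show "\<And>x y. x \<in> L \<Longrightarrow> y \<in> L \<Longrightarrow> x + y \<in> L" "\<And>x y. x \<in> L \<Longrightarrow> y \<in> L \<Longrightarrow> x * y \<in> L"
    "\<And>x. x \<in> L \<Longrightarrow> - x \<in> L" using s(5-7) by auto
  show "inverse x \<in> L" if "x \<in> L" for x
    using CF.subfield_m_inv(1)[OF assms, of x] that \<open>0 \<in> L\<close>
    by (cases "x = 0") (auto simp: complex_field_m_inv)
qed

lemma subring_complex_fieldI:
  assumes "1 \<in> L" "\<And>x y. x \<in> L \<Longrightarrow> y \<in> L \<Longrightarrow> x + y \<in> L"
    "\<And>x y. x \<in> L \<Longrightarrow> y \<in> L \<Longrightarrow> x * y \<in> L" "\<And>x. x \<in> L \<Longrightarrow> - x \<in> L"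
  shows "subring L complex_field"
  using assms by (intro CF.subringI) auto

lemma subfield_complex_fieldI:
  assumes "1 \<in> L" "\<And>x y. x \<in> L \<Longrightarrow> y \<in> L \<Longrightarrow> x + y \<in> L"
    "\<And>x y. x \<in> L \<Longrightarrow> y \<in> L \<Longrightarrow> x * y \<in> L" "\<And>x. x \<in> L \<Longrightarrow> - x \<in> L"
    "\<And>x. x \<in> L \<Longrightarrow> x \<noteq> 0 \<Longrightarrow> inverse x \<in> L"
  shows "subfield L complex_field"
  using assms by (intro field.subfieldI'[OF field_complex_field] subring_complex_fieldI) (auto simp: complex_field_m_inv)

lemma rat_adjoin_sqrt_subfield: "subfield (rat_adjoin_sqrt d) complex_field"
  unfolding rat_adjoin_sqrt_def by (rule field.generate_field_is_subfield[OF field_complex_field]) auto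

lemma csqrt_in_rat_adjoin_sqrt: "csqrt (of_int d) \<in> rat_adjoin_sqrt d"
  unfolding rat_adjoin_sqrt_def by (rule generate_field.incl) simp

lemma rat_adjoin_sqrt_least:
  assumes "subfield L complex_field" "csqrt (of_int d) \<in> L"
  shows "rat_adjoin_sqrt d \<subseteq> L"
  unfolding rat_adjoin_sqrt_def using assms by (intro field.generate_field_min_subfield1[OF field_complex_field]) auto

lemma subfield_complex_field_of_int:
  assumes "subfield L complex_field"
  shows "of_int n \<in> L"
proof -
  note L = subfield_complex_fieldD[OF assms]
  have "of_nat n \<in> L" for n by (induction n) (auto intro: L)
  then show ?thesis by (cases n rule: int_cases2) (auto intro: L)
qed

lemma Rats_subset_subfield:
  assumes "subfield L complex_field"
  shows "\<rat> \<subseteq> L"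
proof
  fix x :: complex assume "x \<in> \<rat>"
  then obtain a b :: int where "x = of_int a / of_int b" by (rule Rats_cases') auto
  then show "x \<in> L"
    using subfield_complex_fieldD(4,6)[OF assms] subfield_complex_field_of_int[OF assms]
    by (metis divide_inverse)
qed

text \<open>The root is an algebraic integer, so if rational it is an integer, and a squarefree
  square is 1.\<close>

lemma csqrt_of_int_irrational:
  assumes "squarefree d" "d \<noteq> 1"
  shows "csqrt (of_int d) \<notin> \<rat>"
proof
  assume "csqrt (of_int d) \<in> \<rat>"
  moreover have "algebraic_int (csqrt (of_int d))"
    by (intro algebraic_int_csqrt int_imp_algebraic_int) auto
  ultimately have "csqrt (of_int d) \<in> \<int>" by (rule rational_algebraic_int_is_int[rotated])
  then obtain n where n: "csqrt (of_int d) = of_int n" by (auto elim: Ints_cases)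
  then have "of_int d = (of_int (n\<^sup>2) :: complex)" by (metis of_int_power power2_csqrt)
  then have "d = n\<^sup>2" by (simp only: of_int_eq_iff)
  moreover from this have "n dvd 1" using squarefreeD[OF assms(1), of n] by simp
  ultimately show False using assms(2) by (auto simp: abs_if split: if_splits)
qed

text \<open>Irrationality enters in the closure under inverses: it keeps the norm a^2 - d b^2 of a
  nonzero element away from 0.\<close>

lemma rat_adjoin_sqrt_eq:
  assumes irr: "csqrt (of_int d) \<notin> \<rat>"
  shows "rat_adjoin_sqrt d = {a + b * csqrt (of_int d) | a b. a \<in> \<rat> \<and> b \<in> \<rat>}"
proof
  let ?w = "csqrt (of_int d)"
  let ?K = "{a + b * ?w | a b. a \<in> \<rat> \<and> b \<in> \<rat>}"
  have w2: "?w * ?w = of_int d" by (metis power2_csqrt power2_eq_square)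
  have KI: "x \<in> ?K" if "x = a + b * ?w" "a \<in> \<rat>" "b \<in> \<rat>" for x a b using that by blast
  show "rat_adjoin_sqrt d \<subseteq> ?K"
  proof (rule rat_adjoin_sqrt_least)
    have "?w = 0 + 1 * ?w" by simp
    then show "?w \<in> ?K" using Rats_0 Rats_1 by blast
    show "subfield ?K complex_field"
    proof (rule subfield_complex_fieldI)
      have "1 = 1 + 0 * ?w" by simp
      then show "1 \<in> ?K" using Rats_0 Rats_1 by blast
    next
      fix x y assume "x \<in> ?K" "y \<in> ?K"
      then obtain a b a' b' where *: "x = a + b * ?w" "y = a' + b' * ?w" "a \<in> \<rat>" "b \<in> \<rat>" "a' \<in> \<rat>" "b' \<in> \<rat>"
        by blast
      have "x + y = (a + a') + (b + b') * ?w" by (simp add: * algebra_simps)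
      then show "x + y \<in> ?K" by (rule KI) (use * in auto)
      have "x * y = (a * a' + b * b' * (?w * ?w)) + (a * b' + b * a') * ?w"
        unfolding * by (simp add: algebra_simps)
      then have "x * y = (a * a' + b * b' * of_int d) + (a * b' + b * a') * ?w" unfolding w2 .
      then show "x * y \<in> ?K" by (rule KI) (use * in auto)
    next
      fix x assume "x \<in> ?K"
      then obtain a b where *: "x = a + b * ?w" "a \<in> \<rat>" "b \<in> \<rat>" by blast
      have "- x = - a + (- b) * ?w" by (simp add: *)
      then show "- x \<in> ?K" by (rule KI) (use * in auto)
      assume "x \<noteq> 0"
      define n where "n = a * a - b * b * of_int d"
      have "x * (a - b * ?w) = a * a - b * b * (?w * ?w)"
        unfolding * by (simp add: algebra_simps)
      then have conj: "x * (a - b * ?w) = n" unfolding w2 n_def .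
      have "n \<noteq> 0"
      proof
        assume "n = 0"
        then have "x * (a - b * ?w) = 0" using conj by (simp only:)
        then have "a - b * ?w = 0" using \<open>x \<noteq> 0\<close> mult_eq_0_iff by blast
        moreover from this have "b \<noteq> 0" using * \<open>x \<noteq> 0\<close> by auto
        ultimately have "?w = a / b" by (simp add: field_simps)
        then show False using irr * by auto
      qed
      then have "inverse x = a / n + (- b / n) * ?w"
        using conj \<open>x \<noteq> 0\<close> by (simp add: field_simps)
      moreover have "n \<in> \<rat>" using * by (auto simp: n_def)
      then have "a / n \<in> \<rat>" "- b / n \<in> \<rat>" using * by auto
      ultimately show "inverse x \<in> ?K" by (rule KI)
    qed
  qed
  show "?K \<subseteq> rat_adjoin_sqrt d"
    using subfield_complex_fieldD(3,4)[OF rat_adjoin_sqrt_subfield] csqrt_in_rat_adjoin_sqrt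
      Rats_subset_subfield[OF rat_adjoin_sqrt_subfield] by blast
qed

text \<open>The dimension is counted by building the field from 0 with the lines through 1 and
  through the root; irrationality keeps the second line outside the first.\<close>

lemma quadratic_field_rat_adjoin_sqrt:
  assumes irr: "csqrt (of_int d) \<notin> \<rat>"
  shows "quadratic_field (rat_adjoin_sqrt d)"
proof -
  let ?w = "csqrt (of_int d)"
  have ext: "CF.line_extension \<rat> v E = {a * v + e | a e. a \<in> \<rat> \<and> e \<in> E}" for v E
    unfolding CF.line_extension_def set_add_def' r_coset_def by auto
  have one: "CF.line_extension \<rat> 1 {0} = \<rat>"
    unfolding ext by auto
  have "CF.dimension (Suc (Suc 0)) \<rat> (CF.line_extension \<rat> ?w (CF.line_extension \<rat> 1 {0}))"
    using irr by (intro CF.Suc_dim) (auto simp: one intro: CF.zero_dim)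
  also have "CF.line_extension \<rat> ?w (CF.line_extension \<rat> 1 {0}) = rat_adjoin_sqrt d"
    unfolding one ext rat_adjoin_sqrt_eq[OF irr] by (auto simp: add.commute)
  finally show ?thesis
    unfolding quadratic_field_def using rat_adjoin_sqrt_subfield by (simp add: numeral_2_eq_2)
qed

text \<open>The point is [s : l sqrt d : 1]. A representative (t s, t^3 l sqrt d, t) with entries in
  L shows t in L by its last entry, and then sqrt d in L by its second.\<close>

lemma X1_has_quadratic_point_over_rat_adjoin_sqrt:
  fixes s l d :: int
  assumes d: "csqrt (of_int d) \<notin> \<rat>" and l: "l \<noteq> 0"
    and form: "X1_form (of_int s) 1 = (of_int (l\<^sup>2 * d) :: complex)"
  shows "X1_has_quadratic_point_over (rat_adjoin_sqrt d)"
proof -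
  let ?w = "csqrt (of_int d)"
  let ?K = "rat_adjoin_sqrt d"
  define v where "v = (of_int s :: complex, of_int l * ?w, 1 :: complex)"
  define P where "P = weighted_rel `` {v}"
  have "(of_int l * ?w)\<^sup>2 = X1_form (of_int s) 1"
    unfolding form by (simp add: power_mult_distrib)
  then have v: "v \<in> X1_cone" by (simp add: v_def X1_cone_def)
  then have "P \<in> X1" unfolding X1_def P_def by (rule quotientI)
  moreover have "field_of_definition P = ?K"
  proof
    have "v \<in> P" using v unfolding P_def weighted_rel_def v_def by (auto intro!: exI[of _ 1])
    moreover have "v \<in> ?K \<times> ?K \<times> ?K"
      using subfield_complex_fieldD(2,4)[OF rat_adjoin_sqrt_subfield] csqrt_in_rat_adjoin_sqrt
        subfield_complex_field_of_int[OF rat_adjoin_sqrt_subfield] by (auto simp: v_def)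
    ultimately show "field_of_definition P \<subseteq> ?K"
      unfolding field_of_definition_def using rat_adjoin_sqrt_subfield by blast
    show "?K \<subseteq> field_of_definition P"
      unfolding field_of_definition_def
    proof (rule Inter_greatest, clarify)
      fix L x assume L: "subfield L complex_field" and ne: "P \<inter> L \<times> L \<times> L \<noteq> {}" and x: "x \<in> ?K"
      from ne obtain t where t: "t \<noteq> 0" "t ^ 3 * (of_int l * ?w) \<in> L" "t \<in> L"
        unfolding P_def weighted_rel_def v_def by auto
      note LD = subfield_complex_fieldD[OF L]
      have "inverse t * inverse t * inverse t * inverse (of_int l) * (t ^ 3 * (of_int l * ?w)) \<in> L"
        by (intro LD t subfield_complex_field_of_int[OF L])
      moreover have "inverse t * inverse t * inverse t * inverse (of_int l) * (t ^ 3 * (of_int l * ?w)) = ?w"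
        using t l by (simp add: power3_eq_cube field_simps)
      ultimately have "?w \<in> L" by simp
      then show "x \<in> L" using rat_adjoin_sqrt_least[OF L] x by blast
    qed
  qed
  ultimately show ?thesis
    unfolding X1_has_quadratic_point_over_def using quadratic_field_rat_adjoin_sqrt[OF d] by blast
qed

text \<open>Squaring sqrt e = a + b sqrt d forces a b = 0, and irrationality of sqrt e then gives a
  = 0; in e = b^2 d squarefreeness leaves b^2 = 1. This turns infinitely many values of d into
  infinitely many fields.\<close>

lemma rat_adjoin_sqrt_inject:
  assumes "squarefree d" "squarefree e" "d \<noteq> 1" "e \<noteq> 1" and eq: "rat_adjoin_sqrt d = rat_adjoin_sqrt e"
  shows "d = e"
proof -
  note irr = csqrt_of_int_irrational[OF assms(1,3)] csqrt_of_int_irrational[OF assms(2,4)]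
  let ?w = "csqrt (of_int d)"
  have "csqrt (of_int e) \<in> rat_adjoin_sqrt d" using csqrt_in_rat_adjoin_sqrt eq by simp
  then obtain a b where ab: "csqrt (of_int e) = a + b * ?w" "a \<in> \<rat>" "b \<in> \<rat>"
    using rat_adjoin_sqrt_eq[OF irr(1)] by auto
  have w2: "?w * ?w = of_int d" by (metis power2_csqrt power2_eq_square)
  have "of_int e = csqrt (of_int e) * csqrt (of_int e)" by (metis power2_csqrt power2_eq_square)
  also have "\<dots> = a * a + b * b * (?w * ?w) + 2 * a * b * ?w" unfolding ab by (simp add: algebra_simps)
  finally have e: "of_int e = a * a + b * b * of_int d + 2 * a * b * ?w" unfolding w2 .
  have "a * b = 0"
  proof (rule ccontr)
    assume "a * b \<noteq> 0"
    then have "?w = (of_int e - (a * a + b * b * of_int d)) / (2 * a * b)" using e by (simp add: field_simps)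
    also have "\<dots> \<in> \<rat>" using ab by (intro Rats_divide) auto
    finally show False using irr by blast
  qed
  moreover have "b \<noteq> 0" using ab irr(2) by auto
  ultimately have e: "of_int e = b * b * of_int d" using e by simp
  from ab(3) obtain m n :: int where mn: "b = of_int m / of_int n" "n > 0" "coprime m n"
    by (rule Rats_cases') auto
  have "of_int (e * n\<^sup>2) = (of_int (d * m\<^sup>2) :: complex)"
    using e mn by (simp add: field_simps power2_eq_square)
  then have en: "e * n\<^sup>2 = d * m\<^sup>2" by (simp only: of_int_eq_iff)
  have "coprime (m\<^sup>2) (n\<^sup>2)" using mn by simp
  then have "m\<^sup>2 dvd e" "n\<^sup>2 dvd d" using en
    by (metis coprime_dvd_mult_left_iff dvd_triv_right, metis coprime_commute coprime_dvd_mult_left_iff dvd_triv_right)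
  then have "is_unit m" "is_unit n" using assms(1,2) squarefreeD by blast+
  then have "m\<^sup>2 = 1" "n\<^sup>2 = 1" by (auto simp: power2_eq_1_iff)
  then show ?thesis using en by simp
qed

section \<open>Prime divisors of the class number\<close>

text \<open>The map f generates an action of the cyclic group of order p on S; without fixed points
  every orbit has exactly p elements, and the orbits partition S.\<close>

lemma prime_dvd_card_if_no_fixpoint:
  assumes p: "prime p" and fin: "finite S" and S: "\<And>x. x \<in> S \<Longrightarrow> f x \<in> S"
    and fp: "\<And>x. x \<in> S \<Longrightarrow> (f ^^ p) x = x" and nofix: "\<And>x. x \<in> S \<Longrightarrow> f x \<noteq> x"
  shows "p dvd card S"
proof -
  define orb where "orb x = range (\<lambda>i. (f ^^ i) x)" for x
  have p0: "p > 0" using p prime_gt_0_nat by blast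
  have orbp: "orb x = (\<lambda>i. (f ^^ i) x) ` {..<p}" if "x \<in> S" for x
  proof -
    have "(f ^^ i) x \<in> (\<lambda>i. (f ^^ i) x) ` {..<p}" for i
      using funpow_mod_eq[OF fp[OF that], of i] p0 by (intro image_eqI[of _ _ "i mod p"]) auto
    then show ?thesis by (auto simp: orb_def)
  qed
  have inS: "(f ^^ i) x \<in> S" if "x \<in> S" for x i by (induction i) (auto intro: S that)
  have mult: "(f ^^ (a * m)) x = x" if "(f ^^ m) x = x" for a m x
    using that by (induction a) (auto simp: funpow_add)
  have card: "card (orb x) = p" if x: "x \<in> S" for x
  proof -
    \<comment> \<open>A repetition among the first p iterates means that some f^(j - i) with 0 < j -
      i < p fixes x; f^p does too, so by Bezout f itself fixes x.\<close>
    have False if ij: "i < j" "j < p" "(f ^^ i) x = (f ^^ j) x" for i j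
    proof -
      have "(f ^^ (p - i)) ((f ^^ i) x) = x"
        using ij(1,2) fp[OF x] by (simp flip: funpow_add[THEN fun_cong, unfolded comp_def])
      moreover have "(f ^^ (p - i)) ((f ^^ j) x) = (f ^^ (j - i)) ((f ^^ p) x)"
        using ij(1,2) by (simp add: add.commute flip: funpow_add[THEN fun_cong, unfolded comp_def])
      ultimately have fix1: "(f ^^ (j - i)) x = x" using ij fp[OF x] by simp
      have "\<not> p dvd j - i" using ij by (auto dest: dvd_imp_le)
      then have "coprime (j - i) p" using p by (simp add: prime_imp_coprime coprime_commute)
      then obtain a b where "a * (j - i) = b * p + 1"
        using bezout_nat[of "j - i" p] ij by (auto simp: mult.commute)
      then have "f ((f ^^ (b * p)) x) = (f ^^ (a * (j - i))) x" by simp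
      then have "f x = x" using mult[OF fix1] mult[OF fp[OF x]] by simp
      then show False using nofix x by blast
    qed
    then have "inj_on (\<lambda>i. (f ^^ i) x) {..<p}"
      by (intro linorder_inj_onI) auto
    then show ?thesis using orbp[OF x] by (simp add: card_image)
  qed
  have orb_sub: "orb y \<subseteq> orb x" if y: "y \<in> orb x" for x y
  proof -
    obtain i where i: "y = (f ^^ i) x" using y by (auto simp: orb_def)
    have "(f ^^ j) y = (f ^^ (j + i)) x" for j by (simp add: i funpow_add)
    then show ?thesis by (auto simp: orb_def)
  qed
  have orb_eq: "orb y = orb x" if x: "x \<in> S" and y: "y \<in> orb x" for x y
  proof
    obtain i where i: "y = (f ^^ i) x" "i < p" using y orbp[OF x] by auto
    have "(f ^^ (p - i)) y = x"
      using i fp[OF x] by (simp flip: funpow_add[THEN fun_cong, unfolded comp_def])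
    then have "x \<in> orb y" by (auto simp: orb_def)
    then show "orb x \<subseteq> orb y" by (rule orb_sub)
  qed (rule orb_sub[OF y])
  have self: "x \<in> orb x" for x unfolding orb_def by (rule range_eqI[of _ _ 0]) simp
  have "S = \<Union> (orb ` S)" using self inS by (auto simp: orb_def)
  moreover have "p dvd card (\<Union> (orb ` S))"
  proof (rule dvd_partition)
    show "finite (\<Union> (orb ` S))" using fin calculation by simp
    show "\<forall>c\<in>orb ` S. p dvd card c" using card by simp
    show "\<forall>c1\<in>orb ` S. \<forall>c2\<in>orb ` S. c1 \<noteq> c2 \<longrightarrow> c1 \<inter> c2 = {}"
      using orb_eq by (metis (no_types, lifting) disjoint_iff imageE)
  qed
  ultimately show ?thesis by simp
qed

lemma prime_dvd_card_quotient:
  assumes r: "equiv A r" and p: "prime p" and A: "\<And>x. x \<in> A \<Longrightarrow> f x \<in> A"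
    and resp: "\<And>x y. (x, y) \<in> r \<Longrightarrow> (f x, f y) \<in> r"
    and fp: "\<And>x. x \<in> A \<Longrightarrow> ((f ^^ p) x, x) \<in> r" and nofix: "\<And>x. x \<in> A \<Longrightarrow> (f x, x) \<notin> r"
  shows "p dvd card (A // r)"
proof (cases "finite (A // r)")
  case True
  \<comment> \<open>The saturated image of a class is again a class, so the induced map involves no
    choice of representatives.\<close>
  define F where "F C = r `` (f ` C)" for C
  have F: "F (r `` {x}) = r `` {f x}" if "x \<in> A" for x
  proof -
    have "(x, x) \<in> r" using r that by (simp add: equiv_class_self equiv_def refl_on_def)
    then have "f x \<in> f ` (r `` {x})" by auto
    moreover have "r `` {f y} = r `` {f x}" if "(x, y) \<in> r" for y
      using equiv_class_eq[OF r resp[OF that]] by simp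
    ultimately show ?thesis unfolding F_def by blast
  qed
  have in_A: "(f ^^ i) x \<in> A" if "x \<in> A" for i x
    by (induction i) (auto intro: A that)
  have Fi: "(F ^^ i) (r `` {x}) = r `` {(f ^^ i) x}" if "x \<in> A" for i x
    by (induction i) (simp_all add: F in_A that)
  show ?thesis
  proof (rule prime_dvd_card_if_no_fixpoint[OF p True])
    fix C assume "C \<in> A // r"
    then obtain x where x: "x \<in> A" "C = r `` {x}" by (rule quotientE)
    show "F C \<in> A // r" using x F A by (simp add: quotientI)
    show "(F ^^ p) C = C" using x Fi equiv_class_eq[OF r fp] by simp
    show "F C \<noteq> C" using x F nofix eq_equiv_class[OF _ r, of "f x" x] by auto
  qed
\<comment> \<open>An infinite quotient has \<open>card\<close> 0, which p divides.\<close>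
qed simp

text \<open>After division by the gcd of e and c the cofactor of e is coprime to that of c, so its
  square divides d and it is a unit.\<close>

lemma power2_dvd_squarefree_mult:
  fixes c e d :: int
  assumes "squarefree d" "e\<^sup>2 dvd d * c\<^sup>2" "e \<noteq> 0"
  shows "e dvd c"
proof -
  obtain e' c' where *: "e = e' * gcd e c" "c = c' * gcd e c" "coprime e' c'"
    using gcd_coprime_exists[of e c] assms(3) by auto
  define g where "g = gcd e c"
  have ec: "e = e' * g" "c = c' * g" using * by (simp_all add: g_def)
  have "g \<noteq> 0" using assms(3) ec by auto
  then have "e'\<^sup>2 dvd d * c'\<^sup>2"
    using assms(2) unfolding ec by (simp add: power_mult_distrib mult.assoc[symmetric])
  moreover have "coprime (e'\<^sup>2) (c'\<^sup>2)" using * by simp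
  ultimately have "e'\<^sup>2 dvd d" by (simp add: coprime_dvd_mult_left_iff)
  then have "is_unit e'" using assms(1) squarefreeD by blast
  then have "e' dvd c'" by (rule unit_imp_dvd)
  then show ?thesis using ec by simp
qed

text \<open>If e is the denominator of r in lowest terms, every e^k divides m, which forces e =
  1.\<close>

lemma Ints_if_bounded_denominators:
  fixes r :: complex
  assumes "r \<in> \<rat>" "m \<noteq> 0" "\<And>k. of_int m * r ^ k \<in> \<int>"
  shows "r \<in> \<int>"
proof -
  obtain a e :: int where r: "r = of_int a / of_int e" "e > 0" "coprime a e"
    using assms(1) by (rule Rats_cases') auto
  have "e ^ k dvd m" for k
  proof -
    obtain n where "of_int m * r ^ k = of_int n" using assms(3)[of k] by (auto elim: Ints_cases)
    then have "of_int (m * a ^ k) = (of_int (n * e ^ k) :: complex)"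
      using r by (simp add: power_divide field_simps)
    then have "m * a ^ k = n * e ^ k" by (simp only: of_int_eq_iff)
    then have "e ^ k dvd m * a ^ k" by simp
    moreover have "coprime (e ^ k) (a ^ k)" using r(3) by (simp add: coprime_commute)
    ultimately show ?thesis by (simp add: coprime_dvd_mult_left_iff)
  qed
  \<comment> \<open>The exponent k = abs m suffices because 2^k > k.\<close>
  from this[of "nat \<bar>m\<bar>"] have le: "e ^ nat \<bar>m\<bar> \<le> \<bar>m\<bar>"
    using assms(2) r(2) by (auto dest: dvd_imp_le_int)
  have "e = 1"
  proof (rule ccontr)
    assume "e \<noteq> 1"
    then have "2 \<le> e" using r(2) by simp
    then have "(2::int) ^ nat \<bar>m\<bar> \<le> e ^ nat \<bar>m\<bar>" by (intro power_mono) auto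
    moreover have "int (nat \<bar>m\<bar>) < 2 ^ nat \<bar>m\<bar>" by (rule of_nat_less_two_power)
    ultimately show False using le by linarith
  qed
  then show ?thesis using r by simp
qed

text \<open>For an ideal \<open>I\<close> this is the product of \<open>I\<close> with the ideal \<open>(\<alpha>, \<beta>)\<close>.\<close>

definition twist :: "complex \<Rightarrow> complex \<Rightarrow> complex set \<Rightarrow> complex set" where
  "twist \<alpha> \<beta> I = {\<alpha> * x + \<beta> * y | x y. x \<in> I \<and> y \<in> I}"

lemma twistI: "x \<in> I \<Longrightarrow> y \<in> I \<Longrightarrow> z = \<alpha> * x + \<beta> * y \<Longrightarrow> z \<in> twist \<alpha> \<beta> I"
  by (auto simp: twist_def)

text \<open>Twisting commutes with principal factors; hence it acts on ideal classes, and its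
  iterates are known once one twist of I has the form \<gamma> I.\<close>

lemma twist_scale: "twist \<alpha> \<beta> ((*) c ` I) = (*) c ` twist \<alpha> \<beta> I"
proof
  show "twist \<alpha> \<beta> ((*) c ` I) \<subseteq> (*) c ` twist \<alpha> \<beta> I"
  proof
    fix z assume "z \<in> twist \<alpha> \<beta> ((*) c ` I)"
    then obtain x y where "x \<in> I" "y \<in> I" "z = \<alpha> * (c * x) + \<beta> * (c * y)"
      by (auto simp: twist_def)
    then show "z \<in> (*) c ` twist \<alpha> \<beta> I"
      by (intro image_eqI[of _ _ "\<alpha> * x + \<beta> * y"] twistI) (auto simp: algebra_simps)
  qed
  show "(*) c ` twist \<alpha> \<beta> I \<subseteq> twist \<alpha> \<beta> ((*) c ` I)"
  proof
    fix z assume "z \<in> (*) c ` twist \<alpha> \<beta> I"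
    then obtain x y where "x \<in> I" "y \<in> I" "z = c * (\<alpha> * x + \<beta> * y)"
      by (auto simp: twist_def)
    then show "z \<in> twist \<alpha> \<beta> ((*) c ` I)"
      by (intro twistI[of "c * x" _ "c * y"]) (auto simp: algebra_simps)
  qed
qed

section \<open>The ring of integers of Q(sqrt d) for negative d congruent to 2 modulo 4\<close>

locale imaginary_quadratic =
  fixes d :: int
  assumes sqfree: "squarefree d" and neg: "d < 0" and mod_4: "d mod 4 = 2"
begin

definition w :: complex where "w = csqrt (of_int d)"
definition K :: "complex set" where "K = rat_adjoin_sqrt d"
text \<open>The order with basis 1, \<open>w\<close>; \<open>carrier_ring_of_integers\<close>
  identifies it with the full ring of integers.\<close>

definition Z :: "complex set" where "Z = {of_int a + of_int b * w | a b. True}"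

lemma w_eq: "w = \<i> * of_real (sqrt (- of_int d))"
proof -
  have "w = csqrt (of_real (of_int d))" by (simp add: w_def)
  also have "\<dots> = \<i> * of_real (sqrt \<bar>of_int d\<bar>)"
    using neg by (subst csqrt_of_real_nonpos) auto
  also have "\<bar>real_of_int d\<bar> = - of_int d" using neg by simp
  finally show ?thesis .
qed

lemma w_square: "w * w = of_int d"
  unfolding w_def by (metis power2_csqrt power2_eq_square)

lemma cnj_w: "cnj w = - w"
  by (simp add: w_eq)

lemma Im_w: "Im w > 0"
  using neg by (simp add: w_eq)

lemma Re_w [simp]: "Re w = 0"
  by (simp add: w_eq)

lemma irr: "csqrt (of_int d) \<notin> \<rat>"
  using csqrt_of_int_irrational[OF sqfree] neg by auto

lemma subfield_K: "subfield K complex_field"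
  unfolding K_def by (rule rat_adjoin_sqrt_subfield)

lemmas K_closed = subfield_complex_fieldD[OF subfield_K]

lemma ZI: "x = of_int a + of_int b * w \<Longrightarrow> x \<in> Z"
  by (auto simp: Z_def)

lemma ZE:
  assumes "x \<in> Z"
  obtains a b where "x = of_int a + of_int b * w"
  using assms by (auto simp: Z_def)

lemma Z_of_int [simp]: "of_int n \<in> Z"
  by (rule ZI[of _ n 0]) simp

lemma Z_0 [simp]: "0 \<in> Z" and Z_1 [simp]: "1 \<in> Z"
  using Z_of_int[of 0] Z_of_int[of 1] by simp_all

lemma Z_w [simp]: "w \<in> Z"
  by (rule ZI[of _ 0 1]) simp

lemma Z_add:
  assumes "x \<in> Z" "y \<in> Z"
  shows "x + y \<in> Z"
proof -
  obtain a b a' b' where "x = of_int a + of_int b * w" "y = of_int a' + of_int b' * w"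
    using assms by (auto elim!: ZE)
  then show ?thesis by (intro ZI[of _ "a + a'" "b + b'"]) (simp add: algebra_simps)
qed

lemma Z_mult:
  assumes "x \<in> Z" "y \<in> Z"
  shows "x * y \<in> Z"
proof -
  obtain a b a' b' where *: "x = of_int a + of_int b * w" "y = of_int a' + of_int b' * w"
    using assms by (auto elim!: ZE)
  have "x * y = of_int (a * a') + of_int (b * b') * (w * w) + of_int (a * b' + a' * b) * w"
    unfolding * by (simp add: algebra_simps)
  then show ?thesis unfolding w_square
    by (intro ZI[of _ "a * a' + b * b' * d" "a * b' + a' * b"]) simp
qed

lemma Z_uminus: "x \<in> Z \<Longrightarrow> - x \<in> Z"
  using Z_mult[OF Z_of_int[of "- 1"], of x] by simp

lemma Z_power: "x \<in> Z \<Longrightarrow> x ^ k \<in> Z"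
  by (induction k) (auto intro: Z_mult)

lemma Z_sum: "(\<And>i. i \<in> A \<Longrightarrow> f i \<in> Z) \<Longrightarrow> sum f A \<in> Z"
  by (induction A rule: infinite_finite_induct) (auto intro: Z_add)

lemma Z_cnj:
  assumes "x \<in> Z"
  shows "cnj x \<in> Z"
proof -
  obtain a b where "x = of_int a + of_int b * w" using assms by (rule ZE)
  then show ?thesis by (intro ZI[of _ a "- b"]) (simp add: cnj_w)
qed

text \<open>As d < 0, complex conjugation is the nontrivial automorphism of \<open>K\<close>, so the
  field norm is the squared modulus.\<close>

lemma norm_Z: "(cmod (of_int a + of_int b * w))\<^sup>2 = of_int (a\<^sup>2 - d * b\<^sup>2)"
proof -
  have "(Im w)\<^sup>2 = - of_int d" using neg by (simp add: w_eq)
  then show ?thesis unfolding cmod_power2 by (simp add: power_mult_distrib)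
qed

lemma mult_cnj_Z: "(of_int a + of_int b * w) * cnj (of_int a + of_int b * w) = of_int (a\<^sup>2 - d * b\<^sup>2)"
  unfolding complex_norm_square[symmetric] norm_Z by simp

lemma Z_real:
  assumes "x \<in> Z" "Im x = 0"
  shows "x \<in> \<int>"
proof -
  obtain a b where x: "x = of_int a + of_int b * w" using assms(1) by (rule ZE)
  then have "of_int b * Im w = 0" using assms(2) by simp
  then have "b = 0" using Im_w by simp
  then show ?thesis using x by simp
qed

lemma Z_coords:
  assumes "of_int a + of_int b * w = of_int a' + of_int b' * w"
  shows "a = a'" "b = b'"
proof -
  from assms have "Re (of_int a + of_int b * w) = Re (of_int a' + of_int b' * w)"
    "Im (of_int a + of_int b * w) = Im (of_int a' + of_int b' * w)" by simp_all
  then show "a = a'" "b = b'" using Im_w by auto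
qed

lemma Z_subset_K: "Z \<subseteq> K"
proof
  fix x assume "x \<in> Z"
  then obtain a b where "x = of_int a + of_int b * w" by (rule ZE)
  moreover have "w \<in> K" unfolding w_def K_def by (rule csqrt_in_rat_adjoin_sqrt)
  ultimately show "x \<in> K"
    using K_closed(3,4) subfield_complex_field_of_int[OF subfield_K] by blast
qed

lemma KE:
  assumes "x \<in> K"
  obtains a b e where "e > 0" "x = (of_int a + of_int b * w) / of_int e"
proof -
  obtain q r where qr: "x = q + r * w" "q \<in> \<rat>" "r \<in> \<rat>"
    using assms unfolding K_def rat_adjoin_sqrt_eq[OF irr] w_def by blast
  obtain a e where ae: "q = of_int a / of_int e" "e > 0" using qr(2) by (rule Rats_cases') auto
  obtain b f where bf: "r = of_int b / of_int f" "f > 0" using qr(3) by (rule Rats_cases') auto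
  show thesis
    by (rule that[of "e * f" "a * f" "b * e"]) (use qr ae bf in \<open>auto simp: field_simps\<close>)
qed

text \<open>
  Trace and norm of \<open>x\<close> inherit the bounded denominators, hence are integers; \<open>d mod 4 = 2\<close> does the rest.
\<close>

lemma in_Z_if_bounded_denominators:
  assumes x: "x \<in> K" and m: "m \<noteq> 0" "\<And>k. of_int m * x ^ k \<in> Z"
  shows "x \<in> Z"
proof -
  obtain a b e where e: "e > 0" and x_eq: "x = (of_int a + of_int b * w) / of_int e"
    using x by (rule KE)
  have cnj_x: "cnj x = (of_int a - of_int b * w) / of_int e" by (simp add: x_eq cnj_w)
  have mc: "of_int m * cnj x ^ k \<in> Z" for k
    using Z_cnj[OF m(2)[of k]] by simp
  define t where "t = (of_int (2 * a) / of_int e :: complex)"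
  define n where "n = (of_int (a\<^sup>2 - d * b\<^sup>2) / of_int (e\<^sup>2) :: complex)"
  have t: "x + cnj x = t" unfolding cnj_x by (simp add: x_eq t_def add_divide_distrib[symmetric])
  have n: "x * cnj x = n"
    using mult_cnj_Z[of a b] by (simp add: x_eq n_def power2_eq_square)
  \<comment> \<open>Each binomial term of (x + cnj x)^k takes one factor m for the power of x and
    one for the power of its conjugate.\<close>
  have "of_int (m * m) * t ^ k \<in> \<int>" for k
  proof (rule Z_real)
    have "of_int (m * m) * t ^ k = (\<Sum>j\<le>k. of_int (int (k choose j)) * ((of_int m * x ^ j) * (of_int m * cnj x ^ (k - j))))"
      unfolding t[symmetric] binomial_ring sum_distrib_left by (intro sum.cong) (auto simp: algebra_simps)
    also have "\<dots> \<in> Z" by (intro Z_sum Z_mult m mc Z_of_int)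
    finally show "of_int (m * m) * t ^ k \<in> Z" .
    show "Im (of_int (m * m) * t ^ k) = 0"
      by (simp add: t_def power_divide flip: of_int_power of_int_mult)
  qed
  then have "t \<in> \<int>" using m(1) by (intro Ints_if_bounded_denominators[of t "m * m"]) (auto simp: t_def)
  have "of_int (m * m) * n ^ k \<in> \<int>" for k
  proof (rule Z_real)
    have "of_int (m * m) * n ^ k = (of_int m * x ^ k) * (of_int m * cnj x ^ k)"
      unfolding n[symmetric] by (simp add: power_mult_distrib)
    also have "\<dots> \<in> Z" by (intro Z_mult m mc)
    finally show "of_int (m * m) * n ^ k \<in> Z" .
    show "Im (of_int (m * m) * n ^ k) = 0"
      by (simp add: n_def power_divide flip: of_int_power of_int_mult of_int_diff)
  qed
  then have "n \<in> \<int>" using m(1) by (intro Ints_if_bounded_denominators[of n "m * m"]) (auto simp: n_def)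
  obtain t' n' where "t = of_int t'" "n = of_int n'"
    using \<open>t \<in> \<int>\<close> \<open>n \<in> \<int>\<close> by (auto elim!: Ints_cases)
  then have "(of_int (2 * a) :: complex) = of_int (t' * e)" "(of_int (a\<^sup>2 - d * b\<^sup>2) :: complex) = of_int (n' * e\<^sup>2)"
    using e by (simp_all add: t_def n_def field_simps)
  then have ta: "2 * a = t' * e" and nn: "a\<^sup>2 - d * b\<^sup>2 = n' * e\<^sup>2"
    by (simp_all only: of_int_eq_iff)
  \<comment> \<open>Eliminating a between trace and norm gives d (2 b / e)^2 = t'^2 - 4 n', so
    squarefreeness of d leaves at most 2 in the denominator of b / e.\<close>
  have "d * (2 * b)\<^sup>2 = (2 * a)\<^sup>2 - 4 * (a\<^sup>2 - d * b\<^sup>2)" by (simp add: power2_eq_square algebra_simps)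
  also have "\<dots> = e\<^sup>2 * (t'\<^sup>2 - 4 * n')" unfolding ta nn by (simp add: power2_eq_square algebra_simps)
  finally have db: "d * (2 * b)\<^sup>2 = e\<^sup>2 * (t'\<^sup>2 - 4 * n')" .
  then have "e\<^sup>2 dvd d * (2 * b)\<^sup>2" by (simp only: dvd_triv_left)
  then have "e dvd 2 * b"
    by (rule power2_dvd_squarefree_mult[OF sqfree]) (use e in simp)
  then obtain s where s: "2 * b = e * s" by (elim dvdE)
  have "e\<^sup>2 * (d * s\<^sup>2) = e\<^sup>2 * (t'\<^sup>2 - 4 * n')"
    using db unfolding s by (simp add: power2_eq_square algebra_simps)
  then have ds: "d * s\<^sup>2 = t'\<^sup>2 - 4 * n'" using e by simp
  have "even d" using mod_4 by presburger
  moreover have "t'\<^sup>2 = d * s\<^sup>2 + 4 * n'" using ds by simp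
  ultimately have "even (t'\<^sup>2)" by (simp only: even_add even_mult_iff even_numeral simp_thms)
  then have "even t'" by simp
  then obtain t2 where t2: "t' = 2 * t2" by (elim evenE)
  \<comment> \<open>For odd s the square s^2 is 1 modulo 4, so d s^2 = t'^2 - 4 n' with t' even
    would make d divisible by 4.\<close>
  have "even s"
  proof (rule ccontr)
    assume "odd s"
    then obtain r where "s = 2 * r + 1" by (elim oddE)
    then have "d = 4 * (t2\<^sup>2 - n' - d * (r\<^sup>2 + r))"
      using ds t2 by (simp add: power2_eq_square algebra_simps)
    then have "d mod 4 = 0" by presburger
    then show False using mod_4 by simp
  qed
  then obtain s2 where s2: "s = 2 * s2" by (elim evenE)
  have "a = t2 * e" "b = s2 * e" using ta s t2 s2 by auto
  then have "x = of_int t2 + of_int s2 * w" using e by (simp add: x_eq field_simps)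
  then show ?thesis by (rule ZI)
qed

text \<open>The monic equation of degree n expresses x^k for k >= n through lower powers, so e^n is
  a common denominator of all powers of x.\<close>

lemma algebraic_int_in_Z:
  assumes x: "x \<in> K" and "algebraic_int x"
  shows "x \<in> Z"
proof -
  from assms(2) obtain p :: "int poly" where p: "poly (map_poly of_int p) x = 0" "lead_coeff p = 1"
    by (auto simp: algebraic_int_altdef_ipoly)
  define n where "n = degree p"
  obtain a b e where e: "e > 0" and x_eq: "x = (of_int a + of_int b * w) / of_int e"
    using x by (rule KE)
  have "(\<Sum>i\<le>n. of_int (coeff p i) * x ^ i) = 0"
    using p(1) by (simp add: poly_altdef n_def degree_map_poly coeff_map_poly)
  then have xn: "x ^ n = - (\<Sum>i<n. of_int (coeff p i) * x ^ i)"
    using p(2) by (simp add: lessThan_Suc_atMost[symmetric] n_def add_eq_0_iff)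
  have "of_int (e ^ n) * x ^ k \<in> Z" for k
  proof (induction k rule: less_induct)
    case (less k)
    show ?case
    proof (cases "k < n")
      case True
      have "(of_int e * x) ^ k = (of_int a + of_int b * w) ^ k" using e by (simp add: x_eq)
      moreover have "of_int (e ^ n) * x ^ k = of_int (e ^ (n - k)) * (of_int e * x) ^ k"
        using True by (simp add: power_mult_distrib mult.assoc[symmetric] flip: power_add)
      ultimately have "of_int (e ^ n) * x ^ k = of_int (e ^ (n - k)) * (of_int a + of_int b * w) ^ k"
        by (simp only:)
      then show ?thesis using Z_mult[OF Z_of_int Z_power[OF ZI[OF refl]]] by (simp only:)
    next
      case False
      have "x ^ k = x ^ (k - n) * x ^ n" using False by (simp flip: power_add)
      then have "of_int (e ^ n) * x ^ k = - (\<Sum>i<n. of_int (coeff p i) * (of_int (e ^ n) * x ^ (k - n + i)))"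
        unfolding xn by (simp add: sum_distrib_left power_add algebra_simps)
      also have "\<dots> \<in> Z" using False by (intro Z_uminus Z_sum Z_mult Z_of_int less.IH) auto
      finally show ?thesis .
    qed
  qed
  then show ?thesis using e by (intro in_Z_if_bounded_denominators[OF x, of "e ^ n"]) auto
qed

lemma Z_algebraic_int:
  assumes "x \<in> Z"
  shows "algebraic_int x"
proof -
  obtain a b where x: "x = of_int a + of_int b * w" using assms by (rule ZE)
  have "x * x = of_int a * of_int a + of_int b * of_int b * (w * w) + 2 * of_int a * of_int b * w"
    by (simp add: x algebra_simps)
  then have "x * x = of_int a * of_int a + of_int b * of_int b * of_int d + 2 * of_int a * of_int b * w"
    unfolding w_square .
  then have "poly (map_poly of_int [:a\<^sup>2 - d * b\<^sup>2, - 2 * a, 1:]) x = 0"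
    by (simp add: x map_poly_pCons power2_eq_square algebra_simps)
  then show ?thesis unfolding algebraic_int_altdef_ipoly
    by (intro exI[of _ "[:a\<^sup>2 - d * b\<^sup>2, - 2 * a, 1:]"]) auto
qed

lemma carrier_ring_of_integers: "carrier (ring_of_integers K) = Z"
  using algebraic_int_in_Z Z_algebraic_int Z_subset_K by (auto simp: ring_of_integers_def)

lemma ring_of_integers_eq: "ring_of_integers K = complex_field\<lparr>carrier := Z\<rparr>"
  using carrier_ring_of_integers by (simp add: ring_of_integers_def)

lemma ring_ring_of_integers: "ring (ring_of_integers K)"
  unfolding ring_of_integers_eq
  by (intro CF.subring_is_ring subring_complex_fieldI Z_1 Z_add Z_mult Z_uminus)

lemma ring_of_integers_simps [simp]:
  "monoid.mult (ring_of_integers K) = (*)" "one (ring_of_integers K) = 1"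
  "zero (ring_of_integers K) = 0" "add (ring_of_integers K) = (+)"
  by (simp_all add: ring_of_integers_eq)

section \<open>Ideals and ideal classes\<close>

lemma nonzero_ideals_iff:
  "I \<in> nonzero_ideals K \<longleftrightarrow> I \<subseteq> Z \<and> 0 \<in> I \<and> I \<noteq> {0} \<and>
     (\<forall>x\<in>I. \<forall>y\<in>I. x + y \<in> I) \<and> (\<forall>x\<in>Z. \<forall>y\<in>I. x * y \<in> I)" (is "_ \<longleftrightarrow> ?R")
proof
  assume "I \<in> nonzero_ideals K"
  then have I: "ideal I (ring_of_integers K)" and nz: "I \<noteq> {0}" by (auto simp: nonzero_ideals_def)
  note sub = ideal.axioms(1)[OF I]
  show ?R
    using nz additive_subgroup.a_subset[OF sub] additive_subgroup.a_closed[OF sub]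
      additive_subgroup.zero_closed[OF sub] ideal.I_l_closed[OF I]
    unfolding carrier_ring_of_integers ring_of_integers_simps by blast
next
  assume R: ?R
  interpret ring "ring_of_integers K" by (rule ring_ring_of_integers)
  \<comment> \<open>Negatives come from multiplication by -1, so the two closure conditions already
    give an additive subgroup.\<close>
  have uminus: "- x \<in> I" if "x \<in> I" for x
  proof -
    have "- 1 * x \<in> I" using R Z_uminus[OF Z_1] that by blast
    then show ?thesis by simp
  qed
  have a_inv: "a_inv (ring_of_integers K) x = - x" if "x \<in> Z" for x
    using minus_equality[of "- x" x] that by (simp add: carrier_ring_of_integers Z_uminus)
  have "ideal I (ring_of_integers K)"
  proof (rule idealI[OF ring_ring_of_integers])
    show "subgroup I (add_monoid (ring_of_integers K))"
      using R uminus a_inv by (intro add.subgroupI) (auto simp: carrier_ring_of_integers)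
    show "x \<otimes>\<^bsub>ring_of_integers K\<^esub> a \<in> I" "a \<otimes>\<^bsub>ring_of_integers K\<^esub> x \<in> I"
      if "a \<in> I" "x \<in> carrier (ring_of_integers K)" for a x
      using R that by (simp_all add: carrier_ring_of_integers mult.commute[of a x])
  qed
  then show "I \<in> nonzero_ideals K" using R by (simp add: nonzero_ideals_def)
qed

lemma ideal_class_relI:
  assumes "I \<in> nonzero_ideals K" "J \<in> nonzero_ideals K" "a \<in> Z" "a \<noteq> 0" "b \<in> Z" "b \<noteq> 0"
    and "(*) a ` I = (*) b ` J"
  shows "(I, J) \<in> ideal_class_rel K"
proof -
  have "\<exists>b\<in>Z - {0}. (*) a ` I = (*) b ` J"
    by (rule bexI[of _ b]) (use assms in simp_all)
  then have "\<exists>a\<in>Z - {0}. \<exists>b\<in>Z - {0}. (*) a ` I = (*) b ` J"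
    by (rule bexI[of _ a]) (use assms in simp)
  then show ?thesis using assms(1,2) unfolding ideal_class_rel_def carrier_ring_of_integers by simp
qed

lemma ideal_class_relE:
  assumes "(I, J) \<in> ideal_class_rel K"
  obtains a b where "I \<in> nonzero_ideals K" "J \<in> nonzero_ideals K" "a \<in> Z" "a \<noteq> 0" "b \<in> Z" "b \<noteq> 0"
    "(*) a ` I = (*) b ` J"
proof -
  have "I \<in> nonzero_ideals K \<and> J \<in> nonzero_ideals K \<and>
     (\<exists>a\<in>Z - {0}. \<exists>b\<in>Z - {0}. (*) a ` I = (*) b ` J)"
    using assms unfolding ideal_class_rel_def carrier_ring_of_integers by simp
  then show thesis by (elim conjE bexE) (rule that; simp)
qed

lemma image_mult_mult: "(*) a ` (*) b ` I = (*) (a * b) ` (I :: complex set)"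
  by (simp add: image_image mult.assoc)

lemma equiv_ideal_class_rel: "equiv (nonzero_ideals K) (ideal_class_rel K)"
proof (rule equivI)
  show "ideal_class_rel K \<subseteq> nonzero_ideals K \<times> nonzero_ideals K"
    by (rule subrelI) (erule ideal_class_relE, simp)
  show "refl_on (nonzero_ideals K) (ideal_class_rel K)"
    by (rule refl_onI) (rule ideal_class_relI[of _ _ 1 1]; simp)
  show "sym (ideal_class_rel K)"
  proof (rule symI)
    fix I J assume "(I, J) \<in> ideal_class_rel K"
    then show "(J, I) \<in> ideal_class_rel K"
    proof (rule ideal_class_relE)
      fix a b assume "I \<in> nonzero_ideals K" "J \<in> nonzero_ideals K" "a \<in> Z" "a \<noteq> 0" "b \<in> Z" "b \<noteq> 0"
        "(*) a ` I = (*) b ` J"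
      then show ?thesis by (intro ideal_class_relI[of J I b a]) simp_all
    qed
  qed
  show "trans (ideal_class_rel K)"
  proof (rule transI)
    fix I J L assume "(I, J) \<in> ideal_class_rel K" "(J, L) \<in> ideal_class_rel K"
    then obtain a b a' b' where I: "I \<in> nonzero_ideals K" and L: "L \<in> nonzero_ideals K"
      and Z: "a \<in> Z" "a \<noteq> 0" "b \<in> Z" "b \<noteq> 0" "a' \<in> Z" "a' \<noteq> 0" "b' \<in> Z" "b' \<noteq> 0"
      and eq: "(*) a ` I = (*) b ` J" "(*) a' ` J = (*) b' ` L"
      by (elim ideal_class_relE) (rule that)
    have "(*) (a' * a) ` I = (*) (b * a') ` J"
      unfolding image_mult_mult[symmetric] eq(1) by (simp only: image_mult_mult mult.commute)
    also have "\<dots> = (*) (b * b') ` L" unfolding image_mult_mult[symmetric] eq(2) ..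
    finally show "(I, L) \<in> ideal_class_rel K"
      using I L Z by (intro ideal_class_relI[of I L "a' * a" "b * b'"]) (simp_all add: Z_mult)
  qed
qed

text \<open>The ideal contains a nonzero integer m, the norm of one of its elements. All \<gamma>^k
  m lie in I and so in \<open>Z\<close>, which bounds the denominators of the powers of
  \<gamma>.\<close>

lemma multiplier_in_Z:
  assumes I: "I \<in> nonzero_ideals K" and \<gamma>: "\<gamma> \<in> K" "\<And>x. x \<in> I \<Longrightarrow> \<gamma> * x \<in> I"
  shows "\<gamma> \<in> Z"
proof -
  note R = I[unfolded nonzero_ideals_iff]
  obtain x where x: "x \<in> I" "x \<noteq> 0" using R by blast
  then obtain a b where ab: "x = of_int a + of_int b * w" using R by (blast elim: ZE)
  define m where "m = a\<^sup>2 - d * b\<^sup>2"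
  have m: "cnj x * x = of_int m" using mult_cnj_Z[of a b] by (simp add: ab m_def mult.commute)
  then have "m \<noteq> 0" using x by auto
  have "cnj x * x \<in> I" using R x Z_cnj by blast
  then have "of_int m \<in> I" by (simp only: m)
  then have "\<gamma> ^ k * of_int m \<in> I" for k
    by (induction k) (auto simp: mult.assoc intro: \<gamma>)
  then have "of_int m * \<gamma> ^ k \<in> Z" for k using R by (metis mult.commute subsetD)
  then show ?thesis using in_Z_if_bounded_denominators[OF \<gamma>(1) \<open>m \<noteq> 0\<close>] by blast
qed

lemma twist_ideal:
  assumes "I \<in> nonzero_ideals K" "\<alpha> \<in> Z" "\<beta> \<in> Z" "\<alpha> \<noteq> 0"
  shows "twist \<alpha> \<beta> I \<in> nonzero_ideals K"
proof -
  note R = assms(1)[unfolded nonzero_ideals_iff]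
  obtain x where x: "x \<in> I" "x \<noteq> 0" using R by blast
  have "\<alpha> * x \<in> twist \<alpha> \<beta> I" by (rule twistI[of x _ 0]) (use R x in simp_all)
  moreover have "\<alpha> * x \<noteq> 0" using x assms by simp
  ultimately have "twist \<alpha> \<beta> I \<noteq> {0}" by blast
  moreover have "twist \<alpha> \<beta> I \<subseteq> Z"
    using R assms by (auto simp: twist_def intro!: Z_add Z_mult)
  moreover have "0 \<in> twist \<alpha> \<beta> I" by (rule twistI[of 0 _ 0]) (use R in auto)
  moreover have "u + v \<in> twist \<alpha> \<beta> I" if uv: "u \<in> twist \<alpha> \<beta> I" "v \<in> twist \<alpha> \<beta> I" for u v
  proof -
    obtain x y x' y' where "x \<in> I" "y \<in> I" "x' \<in> I" "y' \<in> I" "u = \<alpha> * x + \<beta> * y" "v = \<alpha> * x' + \<beta> * y'"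
      using uv by (auto simp: twist_def)
    then show ?thesis using R by (intro twistI[of "x + x'" _ "y + y'"]) (auto simp: algebra_simps)
  qed
  moreover have "z * u \<in> twist \<alpha> \<beta> I" if zu: "z \<in> Z" "u \<in> twist \<alpha> \<beta> I" for z u
  proof -
    obtain x y where "x \<in> I" "y \<in> I" "u = \<alpha> * x + \<beta> * y" using zu by (auto simp: twist_def)
    then show ?thesis using R zu by (intro twistI[of "z * x" _ "z * y"]) (auto simp: algebra_simps)
  qed
  ultimately show ?thesis unfolding nonzero_ideals_iff by blast
qed

text \<open>
  Multiplication by \<open>(\<alpha>, \<beta>)\<close> permutes the ideal classes, and its \<open>p\<close>-th power is the identity. If it fixed the
  class of \<open>I\<close>, then \<open>(\<alpha>, \<beta>) I = \<gamma> I\<close>, and \<open>\<gamma>\<^sup>p\<close> would be associated to \<open>\<delta>\<close>. Inverses in the class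
  group are never needed, and if it were infinite then \<open>card\<close> would be 0.
\<close>

lemma prime_dvd_class_number:
  assumes p: "prime p" and Z: "\<alpha> \<in> Z" "\<beta> \<in> Z" "\<delta> \<in> Z" and nz: "\<alpha> \<noteq> 0" "\<delta> \<noteq> 0"
    and pow: "\<And>I. I \<in> nonzero_ideals K \<Longrightarrow> (twist \<alpha> \<beta> ^^ p) I = (*) \<delta> ` I"
    and nofix: "\<And>\<gamma> u v. \<lbrakk>\<gamma> \<in> Z; u \<in> Z; v \<in> Z; u * v = 1; \<gamma> ^ p = \<delta> * u\<rbrakk> \<Longrightarrow> False"
  shows "p dvd class_number K"
  unfolding class_number_def
proof (rule prime_dvd_card_quotient[OF equiv_ideal_class_rel p])
  fix I assume I: "I \<in> nonzero_ideals K"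
  show "twist \<alpha> \<beta> I \<in> nonzero_ideals K" using twist_ideal I Z nz by blast
  have "(twist \<alpha> \<beta> ^^ i) I \<in> nonzero_ideals K" for i
    by (induction i) (simp_all add: I twist_ideal Z nz(1))
  then show "((twist \<alpha> \<beta> ^^ p) I, I) \<in> ideal_class_rel K"
    by (rule ideal_class_relI[of _ I 1 \<delta>]) (use I Z nz pow[OF I] in simp_all)
  show "(twist \<alpha> \<beta> I, I) \<notin> ideal_class_rel K"
  proof
    assume "(twist \<alpha> \<beta> I, I) \<in> ideal_class_rel K"
    then obtain a b where ab: "a \<in> Z" "a \<noteq> 0" "b \<in> Z" "b \<noteq> 0" and abI: "(*) a ` twist \<alpha> \<beta> I = (*) b ` I"
      by (rule ideal_class_relE)
    define \<gamma> where "\<gamma> = b / a"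
    have \<gamma>0: "\<gamma> \<noteq> 0" using ab by (simp add: \<gamma>_def)
    have \<gamma>K: "\<gamma> \<in> K" using ab Z_subset_K K_closed(4,6) unfolding \<gamma>_def divide_inverse by blast
    have "twist \<alpha> \<beta> I = (*) (1 / a) ` (*) a ` twist \<alpha> \<beta> I"
      unfolding image_mult_mult using ab by simp
    also have "\<dots> = (*) \<gamma> ` I" unfolding abI image_mult_mult by (simp add: \<gamma>_def)
    finally have T: "twist \<alpha> \<beta> I = (*) \<gamma> ` I" .
    have "(twist \<alpha> \<beta> ^^ i) I = (*) (\<gamma> ^ i) ` I" for i
      by (induction i) (simp_all add: twist_scale T image_mult_mult power_Suc2 del: power_Suc)
    then have \<gamma>p: "(*) (\<gamma> ^ p) ` I = (*) \<delta> ` I" using pow[OF I] by simp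
    note R = I[unfolded nonzero_ideals_iff]
    \<comment> \<open>The twist of I lies in I because \<alpha> and \<beta> are in \<open>Z\<close>;
      so \<gamma> stabilizes I and is integral.\<close>
    have "\<gamma> * x \<in> I" if "x \<in> I" for x
    proof -
      have "\<gamma> * x \<in> twist \<alpha> \<beta> I" unfolding T using that by blast
      then show ?thesis using R Z by (auto simp: twist_def)
    qed
    then have \<gamma>Z: "\<gamma> \<in> Z" using multiplier_in_Z[OF I \<gamma>K] by blast
    have K': "\<gamma> ^ p \<in> K" "\<delta> \<in> K" using Z_power[OF \<gamma>Z] Z Z_subset_K by auto
    \<comment> \<open>From \<gamma>^p I = \<delta> I, the quotient \<gamma>^p / \<delta> and its
      inverse both stabilize I: they are the mutually inverse units u and v of
      \<open>nofix\<close>.\<close>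
    have "\<gamma> ^ p / \<delta> * x \<in> I" if "x \<in> I" for x
    proof -
      have "\<gamma> ^ p * x \<in> (*) \<delta> ` I" using that \<gamma>p by blast
      then show ?thesis using nz by auto
    qed
    then have u: "\<gamma> ^ p / \<delta> \<in> Z"
      using K' K_closed(4,6) by (intro multiplier_in_Z[OF I]) (auto simp: divide_inverse)
    have "\<delta> / \<gamma> ^ p * x \<in> I" if "x \<in> I" for x
    proof -
      have "\<delta> * x \<in> (*) (\<gamma> ^ p) ` I" using that \<gamma>p by blast
      then show ?thesis using \<gamma>0 by auto
    qed
    then have v: "\<delta> / \<gamma> ^ p \<in> Z"
      using K' K_closed(4,6) by (intro multiplier_in_Z[OF I]) (auto simp: divide_inverse)
    show False by (rule nofix[OF \<gamma>Z u v]) (use nz \<gamma>0 in auto)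
  qed
next
  fix I J assume "(I, J) \<in> ideal_class_rel K"
  then obtain a b where *: "I \<in> nonzero_ideals K" "J \<in> nonzero_ideals K" "a \<in> Z" "a \<noteq> 0" "b \<in> Z" "b \<noteq> 0"
    and eq: "(*) a ` I = (*) b ` J"
    by (rule ideal_class_relE)
  have "(*) a ` twist \<alpha> \<beta> I = (*) b ` twist \<alpha> \<beta> J"
    unfolding twist_scale[symmetric] eq ..
  then show "(twist \<alpha> \<beta> I, twist \<alpha> \<beta> J) \<in> ideal_class_rel K"
    using * Z nz by (intro ideal_class_relI[of _ _ a b]) (simp_all add: twist_ideal)
qed

section \<open>Ideal classes of order 2 and 5\<close>

lemma norm_unit:
  assumes "u \<in> Z" "v \<in> Z" "u * v = 1"
  shows "cmod u = 1"
proof -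
  \<comment> \<open>Norms from \<open>Z\<close> are natural numbers, and two of them with product 1
    are both 1.\<close>
  have "(cmod x)\<^sup>2 \<in> \<nat>" if x: "x \<in> Z" for x
  proof -
    obtain a b where x: "x = of_int a + of_int b * w" using x by (rule ZE)
    have "d * b\<^sup>2 \<le> 0" using neg by (simp add: mult_nonpos_nonneg)
    then have "0 \<le> a\<^sup>2 - d * b\<^sup>2" using zero_le_power2[of a] by linarith
    then show ?thesis unfolding x norm_Z by (metis of_int_of_nat_eq of_nat_in_Nats zero_le_imp_eq_int)
  qed
  then obtain m n :: nat where mn: "(cmod u)\<^sup>2 = real m" "(cmod v)\<^sup>2 = real n"
    using assms by (metis Nats_cases)
  have "(cmod u)\<^sup>2 * (cmod v)\<^sup>2 = 1" using assms(3) by (metis norm_mult norm_one power_mult_distrib power_one)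
  then have "real (m * n) = 1" by (simp add: mn)
  then have "m = 1" by (simp only: of_nat_eq_1_iff nat_mult_eq_1_iff)
  then have "(cmod u)\<^sup>2 = 1" using mn by simp
  then show ?thesis by (simp add: power2_eq_1_iff) (metis norm_ge_zero not_one_le_zero neg_0_le_iff_le)
qed

text \<open>The square of the ideal (a, w) is generated by a^2, a w and w^2 = -a b, hence equals (a)
  as a and b are coprime. If a were associated to a square, x^2 + a b y^2 = a would be solvable: y =
  0 contradicts squarefreeness of a > 1, and otherwise the left side is at least a b > a.\<close>

lemma two_dvd_class_number:
  assumes d: "d = - (a * b)" and a: "a > 1" and b: "b > 1" and cop: "coprime a b"
  shows "2 dvd class_number K"
proof (rule prime_dvd_class_number[where \<alpha> = "of_int a" and \<beta> = w and \<delta> = "of_int a"])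
  obtain u v where uv: "u * a + v * b = 1" using bezout_int[of a b] cop by auto
  have ww: "w * w = - (of_int a * of_int b)" using w_square by (subst (asm) (3) d) simp
  fix I assume I: "I \<in> nonzero_ideals K"
  note R = I[unfolded nonzero_ideals_iff]
  have RI: "x + y \<in> I" "of_int n * x \<in> I" "w * x \<in> I" "- x \<in> I" if "x \<in> I" "y \<in> I" for x y n
  proof -
    show "x + y \<in> I" "of_int n * x \<in> I" "w * x \<in> I" using R that Z_of_int[of n] Z_w by blast+
    have "- 1 * x \<in> I" using R that Z_uminus[OF Z_1] by blast
    then show "- x \<in> I" by simp
  qed
  have "twist (of_int a) w (twist (of_int a) w I) = (*) (of_int a) ` I"
  proof
    show "twist (of_int a) w (twist (of_int a) w I) \<subseteq> (*) (of_int a) ` I"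
    proof
      fix z assume "z \<in> twist (of_int a) w (twist (of_int a) w I)"
      then obtain x y x' y' where *: "x \<in> I" "y \<in> I" "x' \<in> I" "y' \<in> I"
        "z = of_int a * (of_int a * x + w * y) + w * (of_int a * x' + w * y')"
        unfolding twist_def by blast
      have "z = of_int a * (of_int a * x + w * y + w * x') + (w * w) * y'"
        by (simp add: * algebra_simps)
      then have "z = of_int a * (of_int a * x + w * y + w * x' + - (of_int b * y'))"
        unfolding ww by (simp add: algebra_simps)
      moreover have "of_int a * x + w * y + w * x' + - (of_int b * y') \<in> I"
        using * by (intro RI)
      ultimately show "z \<in> (*) (of_int a) ` I" by blast
    qed
    show "(*) (of_int a) ` I \<subseteq> twist (of_int a) w (twist (of_int a) w I)"
    proof
      fix z assume "z \<in> (*) (of_int a) ` I"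
      then obtain x where x: "x \<in> I" "z = of_int a * x" by blast
      \<comment> \<open>Bezout writes a = u a^2 + v a b, where a b = - w^2.\<close>
      have "of_int u * of_int a + of_int v * of_int b = (1 :: complex)"
        using uv by (metis of_int_1 of_int_add of_int_mult)
      then have "z = of_int a * (of_int u * of_int a + of_int v * of_int b) * x" using x by simp
      then have "z = of_int a * (of_int a * (of_int u * x)) + - (- (of_int a * of_int b)) * (of_int v * x)"
        by (simp add: algebra_simps)
      then have "z = of_int a * (of_int a * (of_int u * x) + w * 0) + w * (of_int a * 0 + w * (- (of_int v * x)))"
        unfolding ww[symmetric] by (simp add: algebra_simps)
      moreover have mem: "of_int a * (of_int u * x) + w * 0 \<in> twist (of_int a) w I"
        "of_int a * 0 + w * (- (of_int v * x)) \<in> twist (of_int a) w I"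
        using RI(2)[OF x(1) x(1), of u] RI(4)[OF RI(2)[OF x(1) x(1), of v] x(1)] R
        by (intro twistI[OF _ _ refl]; simp)+
      ultimately show "z \<in> twist (of_int a) w (twist (of_int a) w I)"
        by (intro twistI[OF mem])
    qed
  qed
  then show "(twist (of_int a) w ^^ 2) I = (*) (of_int a) ` I" by (simp add: numeral_2_eq_2)
next
  fix \<gamma> u v assume *: "\<gamma> \<in> Z" "u \<in> Z" "v \<in> Z" "u * v = 1" "\<gamma>\<^sup>2 = of_int a * u"
  obtain x y where xy: "\<gamma> = of_int x + of_int y * w" using *(1) by (rule ZE)
  have "(cmod \<gamma>)\<^sup>2 = of_int a"
    using *(5) norm_unit[OF *(2-4)] a by (metis norm_power norm_mult mult.right_neutral norm_of_int abs_of_pos of_int_pos zero_less_one order.strict_trans of_int_abs)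
  then have "x\<^sup>2 - d * y\<^sup>2 = a" unfolding xy norm_Z by (simp only: of_int_eq_iff)
  moreover have "d * y\<^sup>2 = - (a * b * y\<^sup>2)" by (subst d) simp
  ultimately have "x\<^sup>2 + a * b * y\<^sup>2 = a" by simp
  show False
  proof (cases "y = 0")
    case True
    then have "x\<^sup>2 = a" using \<open>x\<^sup>2 + a * b * y\<^sup>2 = a\<close> by simp
    moreover have "a dvd d" using d by simp
    ultimately have "is_unit x" using sqfree squarefreeD by blast
    then have "x\<^sup>2 = 1" by (auto simp: abs_if power2_eq_square split: if_splits)
    then show False using \<open>x\<^sup>2 = a\<close> a by simp
  next
    case False
    then have "1 \<le> y\<^sup>2" by (simp add: int_one_le_iff_zero_less)
    then have "a * b * 1 \<le> a * b * y\<^sup>2" using a b by (intro mult_left_mono) auto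
    moreover have "a * 2 \<le> a * b" using a b by (intro mult_left_mono) auto
    ultimately show False using \<open>x\<^sup>2 + a * b * y\<^sup>2 = a\<close> a zero_le_power2[of x] by linarith
  qed
qed (use a in auto)

text \<open>The ideal (N, \<beta>), with \<beta> = A + B w of norm N^5, has fifth power (\<beta>). A
  \<gamma> with \<gamma>^5 associated to \<beta> would have norm N < -d, so it would be a rational
  integer dividing both A and N, against coprimality and N > 1.\<close>

lemma five_dvd_class_number:
  assumes N: "1 < N" "N < - d" and AB: "A\<^sup>2 - d * B\<^sup>2 = N ^ 5" and cop: "coprime (2 * A) N"
  shows "5 dvd class_number K"
proof -
  define \<beta> where "\<beta> = of_int A + of_int B * w"
  define \<beta>' where "\<beta>' = of_int A - of_int B * w"
  define n where "n = (of_int N :: complex)"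
  have \<beta>\<beta>': "\<beta> * \<beta>' = n ^ 5"
  proof -
    have "\<beta> * \<beta>' = of_int A * of_int A - of_int B * of_int B * (w * w)"
      by (simp add: \<beta>_def \<beta>'_def algebra_simps)
    also have "\<dots> = of_int (A\<^sup>2 - d * B\<^sup>2)" unfolding w_square by (simp add: power2_eq_square)
    finally show ?thesis unfolding AB n_def by simp
  qed
  have \<beta>Z: "\<beta> \<in> Z" "\<beta>' \<in> Z" "n \<in> Z" unfolding \<beta>_def n_def \<beta>'_def by (auto intro: ZI[of _ A B] ZI[of _ A "- B"])
  have n0: "n \<noteq> 0" using N by (simp add: n_def)
  then have \<beta>0: "\<beta> \<noteq> 0" using \<beta>\<beta>' by auto
  obtain u v where "u * (2 * A) + v * N = 1" using bezout_int[of "2 * A" N] cop by auto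
  then have "of_int (u * (2 * A) + v * N) = (1 :: complex)" by (simp only: of_int_1)
  then have uv: "of_int u * (\<beta> + \<beta>') + of_int v * n = 1" by (simp add: \<beta>_def \<beta>'_def n_def)
  show ?thesis
  proof (rule prime_dvd_class_number[where \<alpha> = n and \<beta> = \<beta> and \<delta> = \<beta>])
    fix I assume I: "I \<in> nonzero_ideals K"
    note R = I[unfolded nonzero_ideals_iff]
    have RI: "x + y \<in> I" "z * x \<in> I" if "x \<in> I" "y \<in> I" "z \<in> Z" for x y z
      using R that by auto
    \<comment> \<open>In ideals, (n, \<beta>) (n^k, \<beta>) = (n^(k + 1), \<beta>): the elements n
      \<beta>, \<beta>^2 and \<beta> \<beta>' = n^5 recover \<beta> because \<beta> + \<beta>' = 2 A
      is coprime to N, and k <= 4 makes n^5 a multiple of n^(k + 1).\<close>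
    have step: "twist n \<beta> (twist (n ^ k) \<beta> I) = twist (n ^ Suc k) \<beta> I" if k: "k \<le> 4" for k
    proof
      show "twist n \<beta> (twist (n ^ k) \<beta> I) \<subseteq> twist (n ^ Suc k) \<beta> I"
      proof
        fix z assume "z \<in> twist n \<beta> (twist (n ^ k) \<beta> I)"
        then obtain x y x' y' where *: "x \<in> I" "y \<in> I" "x' \<in> I" "y' \<in> I"
          "z = n * (n ^ k * x + \<beta> * y) + \<beta> * (n ^ k * x' + \<beta> * y')"
          unfolding twist_def by blast
        have "z = n ^ Suc k * x + \<beta> * (n * y + n ^ k * x' + \<beta> * y')"
          by (simp add: * algebra_simps)
        moreover have "n * y + n ^ k * x' + \<beta> * y' \<in> I"
          using * R Z_power \<beta>Z by auto
        ultimately show "z \<in> twist (n ^ Suc k) \<beta> I" using *(1) by (intro twistI)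
      qed
      show "twist (n ^ Suc k) \<beta> I \<subseteq> twist n \<beta> (twist (n ^ k) \<beta> I)"
      proof
        fix z assume "z \<in> twist (n ^ Suc k) \<beta> I"
        then obtain x y where *: "x \<in> I" "y \<in> I" "z = n ^ Suc k * x + \<beta> * y"
          unfolding twist_def by blast
        have n5: "n ^ 5 = n ^ Suc k * n ^ (4 - k)" using k by (simp flip: power_add power_Suc)
        have "\<beta> = (of_int u * (\<beta> + \<beta>') + of_int v * n) * \<beta>" unfolding uv by simp
        also have "\<dots> = of_int u * \<beta> * \<beta> + of_int u * (\<beta> * \<beta>') + of_int v * n * \<beta>"
          by (simp add: algebra_simps)
        finally have "\<beta> * y = (of_int u * \<beta> * \<beta> + of_int u * (n ^ Suc k * n ^ (4 - k)) + of_int v * n * \<beta>) * y"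
          unfolding \<beta>\<beta>' n5 by simp
        then have "z = n ^ Suc k * x + (of_int u * \<beta> * \<beta> + of_int u * (n ^ Suc k * n ^ (4 - k)) + of_int v * n * \<beta>) * y"
          using *(3) by simp
        then have "z = n * (n ^ k * (x + of_int u * n ^ (4 - k) * y) + \<beta> * (of_int v * y))
            + \<beta> * (n ^ k * 0 + \<beta> * (of_int u * y))"
          by (simp add: algebra_simps)
        moreover have "x + of_int u * n ^ (4 - k) * y \<in> I" "of_int v * y \<in> I" "of_int u * y \<in> I" "0 \<in> I"
          using * R Z_mult[OF Z_of_int[of u] Z_power[OF \<beta>Z(3), of "4 - k"]] Z_of_int[of u] Z_of_int[of v]
          by simp_all
        then have mem: "n ^ k * (x + of_int u * n ^ (4 - k) * y) + \<beta> * (of_int v * y) \<in> twist (n ^ k) \<beta> I"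
          "n ^ k * 0 + \<beta> * (of_int u * y) \<in> twist (n ^ k) \<beta> I"
          by (intro twistI[OF _ _ refl]; simp)+
        ultimately show "z \<in> twist n \<beta> (twist (n ^ k) \<beta> I)"
          by (intro twistI[OF mem])
      qed
    qed
    have "(twist n \<beta> ^^ Suc k) I = twist (n ^ Suc k) \<beta> I" if "k \<le> 4" for k
      using that
    proof (induction k)
      case (Suc k)
      then show ?case using step[of "Suc k"] by simp
    qed simp
    from this[of 4] have "(twist n \<beta> ^^ 5) I = twist (n ^ 5) \<beta> I"
      by (simp add: eval_nat_numeral)
    \<comment> \<open>Since \<beta> \<beta>' = n^5, the ideal (n^5, \<beta>) is (\<beta>).\<close>
    also have "\<dots> = (*) \<beta> ` I"
    proof
      show "twist (n ^ 5) \<beta> I \<subseteq> (*) \<beta> ` I"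
      proof
        fix z assume "z \<in> twist (n ^ 5) \<beta> I"
        then obtain x y where *: "x \<in> I" "y \<in> I" "z = n ^ 5 * x + \<beta> * y"
          unfolding twist_def by blast
        have "z = \<beta> * (\<beta>' * x + y)" unfolding *(3) \<beta>\<beta>'[symmetric] by (simp add: algebra_simps)
        moreover have "\<beta>' * x + y \<in> I" using * R \<beta>Z by auto
        ultimately show "z \<in> (*) \<beta> ` I" by blast
      qed
      show "(*) \<beta> ` I \<subseteq> twist (n ^ 5) \<beta> I"
        using R by (auto intro!: twistI[of 0])
    qed
    finally show "(twist n \<beta> ^^ 5) I = (*) \<beta> ` I" .
  next
    fix \<gamma> u v assume *: "\<gamma> \<in> Z" "u \<in> Z" "v \<in> Z" "u * v = 1" "\<gamma> ^ 5 = \<beta> * u"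
    obtain x y where xy: "\<gamma> = of_int x + of_int y * w" using *(1) by (rule ZE)
    have "(cmod \<beta>)\<^sup>2 = (of_int N) ^ 5" unfolding \<beta>_def norm_Z AB by simp
    moreover have "(cmod \<gamma>) ^ 5 = cmod \<beta>"
      using *(5) norm_unit[OF *(2-4)] by (metis norm_power norm_mult mult.right_neutral)
    ultimately have "((cmod \<gamma>)\<^sup>2) ^ 5 = (of_int N) ^ 5"
      by (metis power_mult mult.commute)
    then have "(cmod \<gamma>)\<^sup>2 = of_int N"
      by (rule power_eq_imp_eq_base) (use N in auto)
    then have "x\<^sup>2 - d * y\<^sup>2 = N" unfolding xy norm_Z by (simp only: of_int_eq_iff)
    have "y = 0"
    proof (rule ccontr)
      assume "y \<noteq> 0"
      then have "1 \<le> y\<^sup>2" by (simp add: int_one_le_iff_zero_less)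
      then have "- d * 1 \<le> - d * y\<^sup>2" using neg by (intro mult_left_mono) auto
      then show False using N(2) \<open>x\<^sup>2 - d * y\<^sup>2 = N\<close> zero_le_power2[of x] by linarith
    qed
    then have xN: "x\<^sup>2 = N" using \<open>x\<^sup>2 - d * y\<^sup>2 = N\<close> by simp
    obtain r s where rs: "v = of_int r + of_int s * w" using *(3) by (rule ZE)
    have "\<beta> = \<gamma> ^ 5 * v" using *(4,5) by (simp add: mult.assoc)
    also have "\<dots> = of_int (x ^ 5 * r) + of_int (x ^ 5 * s) * w"
      unfolding xy rs \<open>y = 0\<close> by (simp add: algebra_simps)
    finally have "A = x ^ 5 * r" unfolding \<beta>_def by (rule Z_coords)
    then have "x dvd 2 * A" by simp
    moreover have "x dvd N" unfolding xN[symmetric] by simp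
    ultimately have "is_unit x" using cop by (meson coprime_common_divisor)
    then have "x\<^sup>2 = 1" by (auto simp: abs_if power2_eq_square split: if_splits)
    then show False using xN N by simp
  qed (use \<beta>Z n0 \<beta>0 in auto)
qed

end

text \<open>Starting the progression at r + p^2 m instead of r pushes t beyond any given m.\<close>

lemma infinite_admissible:
  fixes p r Q :: nat
  assumes p: "prime p" "\<not> p\<^sup>2 dvd r" and Q: "fact 20 * p dvd Q" "Q > 0"
  shows "infinite {t. 0 < t \<and> [t = r] (mod p\<^sup>2) \<and> admissible Q t}"
  unfolding infinite_nat_iff_unbounded_le
proof
  fix m
  have "\<not> p\<^sup>2 dvd r + p\<^sup>2 * m" using p(2) by (simp add: dvd_add_left_iff)
  from exists_admissible[OF p(1) this Q] obtain k where k: "admissible Q (r + p\<^sup>2 * m + p\<^sup>2 * k)" ..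
  define t where "t = r + p\<^sup>2 * m + p\<^sup>2 * k"
  have "1 * m \<le> p\<^sup>2 * m" using p(1) by (intro mult_le_mono1) (simp add: Suc_le_eq prime_gt_0_nat)
  then have "m \<le> t" unfolding t_def by linarith
  moreover have "0 < t" using p(2) by (cases r) (auto simp: t_def)
  moreover have "[t = r] (mod p\<^sup>2)"
    by (simp add: t_def cong_def add.assoc flip: distrib_left)
  ultimately show "\<exists>n\<ge>m. n \<in> {t. 0 < t \<and> [t = r] (mod p\<^sup>2) \<and> admissible Q t}"
    using k by (auto simp: t_def)
qed

section \<open>The family of discriminants\<close>

lemma is_unit_if_odd_dvd_two_power:
  fixes c :: int
  assumes "odd c" "c dvd 2 ^ n"
  shows "is_unit c"
proof -
  have "coprime c (2 ^ n)" using assms(1) by simp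
  then show ?thesis using assms(2) coprime_absorb_left by blast
qed

lemma coprime_quadratic_factors:
  fixes s :: int
  assumes "even s"
  shows "coprime s (s\<^sup>2 + 1)" "coprime s (s\<^sup>2 - 2 * s - 1)" "coprime (s\<^sup>2 + 1) (s\<^sup>2 - 2 * s - 1)"
proof -
  show "coprime s (s\<^sup>2 + 1)"
  proof (rule coprimeI)
    fix c assume c: "c dvd s" "c dvd s\<^sup>2 + 1"
    have "c dvd (s\<^sup>2 + 1) - s * s" using c(2) dvd_mult[OF c(1)] by (rule dvd_diff)
    then show "is_unit c" by (simp add: power2_eq_square)
  qed
  show "coprime s (s\<^sup>2 - 2 * s - 1)"
  proof (rule coprimeI)
    fix c assume c: "c dvd s" "c dvd s\<^sup>2 - 2 * s - 1"
    have "c dvd (s - 2) * s - (s\<^sup>2 - 2 * s - 1)" using dvd_mult[OF c(1)] c(2) by (rule dvd_diff)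
    then show "is_unit c" by (simp add: power2_eq_square algebra_simps)
  qed
  show "coprime (s\<^sup>2 + 1) (s\<^sup>2 - 2 * s - 1)"
  proof (rule coprimeI)
    fix c assume c: "c dvd s\<^sup>2 + 1" "c dvd s\<^sup>2 - 2 * s - 1"
    \<comment> \<open>The difference of the two factors is 2 s + 2, and 2 (s^2 + 1) - (s - 1) (2 s +
      2) = 4; c is odd because s^2 + 1 is.\<close>
    have "c dvd 2 * (s\<^sup>2 + 1) - (s - 1) * ((s\<^sup>2 + 1) - (s\<^sup>2 - 2 * s - 1))"
      using dvd_mult[OF c(1)] dvd_mult[OF dvd_diff[OF c]] by (rule dvd_diff)
    also have "\<dots> = 2 ^ 2" by (simp add: power2_eq_square algebra_simps)
    finally have "c dvd 2 ^ 2" .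
    moreover have "odd c" using dvd_trans[OF _ c(1), of 2] assms by auto
    ultimately show "is_unit c" by (rule is_unit_if_odd_dvd_two_power[rotated])
  qed
qed

text \<open>With s = Q t, the product Q * \<open>disc Q t\<close> is the right-hand side of the
  curve at x = s. For Q = l^2 the two numbers therefore differ by a square factor.\<close>

definition disc :: "nat \<Rightarrow> nat \<Rightarrow> int" where
  "disc Q t = - (int t * ((int (Q * t))\<^sup>2 + 1) * ((int (Q * t))\<^sup>2 - 2 * int (Q * t) - 1))"

lemma squarefree_disc:
  assumes "even Q" "admissible Q t"
  shows "squarefree (disc Q t)"
proof -
  define s where "s = int (Q * t)"
  note cop = coprime_quadratic_factors[of s]
  have "even s" "int t dvd s" using assms(1) by (simp_all add: s_def)
  then have "coprime (int t) (s\<^sup>2 + 1)" "coprime (int t) (s\<^sup>2 - 2 * s - 1)"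
    using cop(1,2) by (metis coprime_divisors dvd_refl)+
  moreover have "squarefree (int t)" using assms(2) by (simp add: admissible_def)
  ultimately show ?thesis
    using assms(2) cop(3) \<open>even s\<close> unfolding disc_def admissible_def s_def[symmetric] squarefree_minus
    by (intro squarefree_mult_coprime) simp_all
qed

text \<open>The first bound makes the values unbounded in t; the second is the condition N < -d of
  \<open>five_dvd_class_number\<close> for N = (s - 1)^2.\<close>

lemma disc_bounds:
  assumes "4 \<le> Q" "0 < t"
  shows "int t \<le> - disc Q t" "(int (Q * t) - 1)\<^sup>2 < - disc Q t" 
proof -
  define s where "s = int (Q * t)"
  have "3 * 1 \<le> Q * t" using assms by (intro mult_le_mono) auto
  then have s: "3 \<le> s" unfolding s_def by linarith
  then have "3 * s \<le> s\<^sup>2" unfolding power2_eq_square by (intro mult_right_mono) auto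
  then have g: "1 \<le> s\<^sup>2 - 2 * s - 1" using s by linarith
  have "int t * 1 * 1 \<le> int t * (s\<^sup>2 + 1) * (s\<^sup>2 - 2 * s - 1)"
    using g assms by (intro mult_mono) auto
  then show "int t \<le> - disc Q t" by (simp add: disc_def s_def)
  have "(s - 1)\<^sup>2 < 1 * (s\<^sup>2 + 1) * 1" using s by (simp add: power2_eq_square algebra_simps)
  also have "\<dots> \<le> int t * (s\<^sup>2 + 1) * (s\<^sup>2 - 2 * s - 1)"
    using g assms by (intro mult_mono) auto
  finally show "(int (Q * t) - 1)\<^sup>2 < - disc Q t" by (simp add: disc_def s_def)
qed

text \<open>Modulo Q the number Q t vanishes, and -t * 1 * (-1) = t is left.\<close>

lemma disc_cong: "[disc Q t = int t] (mod int Q)"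
proof -
  have "disc Q t - int t = int Q * - (int t * int t * ((int (Q * t)) ^ 3 - 2 * (int (Q * t))\<^sup>2 - 2))"
    by (simp add: disc_def power2_eq_square power3_eq_cube algebra_simps)
  then show ?thesis unfolding cong_iff_dvd_diff by simp
qed

lemma infinite_image_disc:
  assumes "infinite T" "4 \<le> Q" "\<And>t. t \<in> T \<Longrightarrow> 0 < t"
  shows "infinite (disc Q ` T)"
proof
  assume "finite (disc Q ` T)"
  then have "finite ((\<lambda>d. nat (- d)) ` disc Q ` T)" by simp
  then obtain B where B: "\<And>t. t \<in> T \<Longrightarrow> nat (- disc Q t) \<le> B"
    unfolding finite_nat_set_iff_bounded_le by auto
  have "t \<le> B" if "t \<in> T" for t
    using B[OF that] disc_bounds(1)[OF assms(2), of t] assms(3)[OF that] by linarith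
  then have "T \<subseteq> {..B}" by auto
  then show False using assms(1) finite_subset by blast
qed

lemma even_square_bounds:
  fixes l :: nat
  assumes "even l" "l \<noteq> 0"
  shows "4 \<le> l\<^sup>2" "even (l\<^sup>2)" "4 dvd int (l\<^sup>2)"
proof -
  obtain k where k: "l = 2 * k" using assms(1) by (elim evenE)
  have "2 \<le> l" using k assms(2) by simp
  then have "2\<^sup>2 \<le> l\<^sup>2" by (rule power_mono) simp
  then show "4 \<le> l\<^sup>2" by simp
  show "even (l\<^sup>2)" "4 dvd int (l\<^sup>2)" by (simp_all add: k power2_eq_square)
qed

lemma X1_has_quadratic_point_over_disc:
  assumes "admissible (l\<^sup>2) t" "even l" "l \<noteq> 0" "0 < t"
  shows "X1_has_quadratic_point_over (rat_adjoin_sqrt (disc (l\<^sup>2) t))"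
proof (rule X1_has_quadratic_point_over_rat_adjoin_sqrt)
  note Q = even_square_bounds[OF assms(2,3)]
  have "disc (l\<^sup>2) t < 0" using disc_bounds(1)[OF Q(1) assms(4)] assms(4) by linarith
  then show "csqrt (of_int (disc (l\<^sup>2) t)) \<notin> \<rat>"
    by (intro csqrt_of_int_irrational squarefree_disc Q(2) assms(1)) simp
  show "X1_form (of_int (int (l\<^sup>2 * t))) 1 = (of_int ((int l)\<^sup>2 * disc (l\<^sup>2) t) :: complex)"
    by (simp add: X1_form_def disc_def)
  show "int l \<noteq> 0" using assms(3) by simp
qed

lemma ten_dvd_class_number_disc:
  assumes admissible: "admissible (l\<^sup>2) t" and l: "even l" "l \<noteq> 0" and t: "0 < t" "t mod 4 = 2"
  shows "imaginary_quadratic_field (rat_adjoin_sqrt (disc (l\<^sup>2) t)) \<and>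
         10 dvd class_number (rat_adjoin_sqrt (disc (l\<^sup>2) t))"
proof -
  define d where "d = disc (l\<^sup>2) t"
  define s where "s = int (l\<^sup>2 * t)"
  note Q = even_square_bounds[OF l]
  \<comment> \<open>As 4 divides Q = l^2, d inherits the residue 2 modulo 4 from t.\<close>
  have "[d = int t] (mod 4)" using disc_cong Q(3) unfolding d_def by (rule cong_dvd_modulus)
  then have "d mod 4 = int (t mod 4)" by (simp add: cong_def zmod_int)
  then have mod4: "d mod 4 = 2" using t(2) by simp
  have neg: "d < 0" using disc_bounds(1)[OF Q(1) t(1)] t unfolding d_def by linarith
  have sqf: "squarefree d" unfolding d_def by (rule squarefree_disc[OF Q(2) admissible])
  interpret imaginary_quadratic d by unfold_locales fact+
  have "2 \<le> t" using t by presburger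
  with Q(1) have "4 * 2 \<le> l\<^sup>2 * t" by (intro mult_le_mono)
  then have s8: "8 \<le> s" unfolding s_def by linarith
  then have "8 * s \<le> s\<^sup>2" unfolding power2_eq_square by (intro mult_right_mono) auto
  then have g: "1 < s\<^sup>2 - 2 * s - 1" "1 < s\<^sup>2 + 1" using s8 by linarith+
  have "even s" using Q(2) by (simp add: s_def)
  note cop = coprime_quadratic_factors[OF \<open>even s\<close>]
  have "2 dvd class_number K"
  proof (rule two_dvd_class_number)
    show "d = - (int t * (s\<^sup>2 + 1) * (s\<^sup>2 - 2 * s - 1))" by (simp add: d_def disc_def s_def)
    have "1 * 1 < int t * (s\<^sup>2 + 1)" using t g by (intro mult_le_less_imp_less) auto
    then show "1 < int t * (s\<^sup>2 + 1)" by simp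
    have "coprime (int t) (s\<^sup>2 - 2 * s - 1)"
      using cop(2) by (rule coprime_divisors[rotated 2]) (simp_all add: s_def)
    then show "coprime (int t * (s\<^sup>2 + 1)) (s\<^sup>2 - 2 * s - 1)" using cop(3) by simp
  qed (rule g)
  moreover have "5 dvd class_number K"
  proof (rule five_dvd_class_number)
    \<comment> \<open>With X and Y as defined below, X + Y = (s - 1)^5, \<open>?A\<close> = X - Y
      and d \<open>?B\<close>^2 = -4 X Y, so \<open>?A\<close> + \<open>?B\<close> w has norm (X +
      Y)^2 = (s - 1)^10. The factor l in \<open>?B\<close> makes up for d containing t in place of s
      = l^2 t.\<close>
    let ?A = "s * (s\<^sup>2 + 1) * (s - 3)\<^sup>2 - (s\<^sup>2 - 2 * s - 1) * (s + 1)\<^sup>2"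
    let ?B = "2 * (s - 3) * (s + 1) * int l"
    have "7\<^sup>2 \<le> (s - 1)\<^sup>2" using s8 by (intro power_mono) auto
    then show "1 < (s - 1)\<^sup>2" by simp
    show "(s - 1)\<^sup>2 < - d" using disc_bounds(2)[OF Q(1) t(1)] by (simp add: d_def s_def)
    define X where "X = s * (s\<^sup>2 + 1) * (s - 3)\<^sup>2"
    define Y where "Y = (s\<^sup>2 - 2 * s - 1) * (s + 1)\<^sup>2"
    have "(int l)\<^sup>2 * d = - (s * (s\<^sup>2 + 1) * (s\<^sup>2 - 2 * s - 1))" by (simp add: d_def disc_def s_def)
    moreover have "d * ?B\<^sup>2 = ((int l)\<^sup>2 * d) * (4 * (s - 3)\<^sup>2 * (s + 1)\<^sup>2)"
      by Groebner_Basis.algebra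
    ultimately have "d * ?B\<^sup>2 = - (s * (s\<^sup>2 + 1) * (s\<^sup>2 - 2 * s - 1)) * (4 * (s - 3)\<^sup>2 * (s + 1)\<^sup>2)"
      by (simp only:)
    also have "\<dots> = - (4 * X * Y)" by (simp add: X_def Y_def)
    finally have "?A\<^sup>2 - d * ?B\<^sup>2 = (X - Y)\<^sup>2 + 4 * X * Y"
      by (simp only: X_def Y_def diff_minus_eq_add)
    also have "\<dots> = (X + Y)\<^sup>2" by Groebner_Basis.algebra
    also have "X + Y = (s - 1) ^ 5"
      unfolding X_def Y_def by Groebner_Basis.algebra
    finally show "?A\<^sup>2 - d * ?B\<^sup>2 = ((s - 1)\<^sup>2) ^ 5" by (simp flip: power_mult)
    have "coprime (2 * ?A) (s - 1)"
    proof (rule coprimeI)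
      fix c assume c: "c dvd 2 * ?A" "c dvd s - 1"
      \<comment> \<open>The quartic is the quotient of \<open>?A\<close> by s - 1; the remainder is
        the value 16 of \<open>?A\<close> at s = 1.\<close>
      have "c dvd 2 * ?A - 2 * (s ^ 4 - 6 * s ^ 3 + 4 * s\<^sup>2 + 2 * s + 15) * (s - 1)"
        using c(1) dvd_mult[OF c(2)] by (rule dvd_diff)
      also have "\<dots> = 2 ^ 5" by Groebner_Basis.algebra
      finally have "c dvd 2 ^ 5" .
      moreover have "odd c" using dvd_trans[OF _ c(2), of 2] \<open>even s\<close> by auto
      ultimately show "is_unit c" by (rule is_unit_if_odd_dvd_two_power[rotated])
    qed
    then show "coprime (2 * ?A) ((s - 1)\<^sup>2)" by simp
  qed
  ultimately have "10 dvd class_number K" by presburger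
  moreover have "imaginary_quadratic_field K"
  proof -
    have "w \<in> K" unfolding w_def K_def by (rule csqrt_in_rat_adjoin_sqrt)
    moreover have "w \<notin> \<real>" using Im_w by (auto simp: complex_is_Real_iff)
    ultimately have "\<not> K \<subseteq> \<real>" by blast
    then show ?thesis
      using quadratic_field_rat_adjoin_sqrt[OF irr] by (simp add: imaginary_quadratic_field_def K_def)
  qed
  ultimately show ?thesis by (simp only: K_def flip: d_def)
qed

section \<open>Infinitely many d in a residue class, infinitely many fields\<close>

theorem theorem1p9:
  shows "(\<forall>p a :: int. prime p \<longrightarrow>
            infinite {d :: int. squarefree d \<and> [d = a] (mod p) \<and>
                                X1_has_quadratic_point_over (rat_adjoin_sqrt d)})
       \<and> infinite {K. imaginary_quadratic_field K \<and> 10 dvd class_number K \<and>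
                      X1_has_quadratic_point_over K}"
proof (intro conjI allI impI)
  have even_fact: "even (fact 20 :: nat)" by (rule dvd_fact) auto
  fix p a :: int assume p: "prime p"
  define P where "P = nat p"
  have P: "prime P" "p = int P" using p by (auto simp: P_def prime_nat_iff_prime prime_ge_0_int)
  \<comment> \<open>The class of 0 is represented by p rather than 0, so that p^2 does not divide
    r.\<close>
  define r where "r = (if a mod p = 0 then P else nat (a mod p))"
  \<comment> \<open>The factor p of l makes d congruent to t modulo p; the factor 20! serves the
    sieve.\<close>
  define l where "l = fact 20 * P"
  have "P > 1" using P(1) by (rule prime_gt_1_nat)
  have r: "0 < r \<and> r \<le> P \<and> [int r = a] (mod p)"
  proof (cases "a mod p = 0")
    case True
    then show ?thesis using \<open>P > 1\<close> P(2) by (simp add: r_def cong_def)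
  next
    case False
    have "a mod p < p" "0 \<le> a mod p" using \<open>P > 1\<close> P(2) by auto
    then have "int r = a mod p" "0 < int r" "int r < int P" using False P(2) by (auto simp: r_def)
    then show ?thesis by (simp add: cong_def)
  qed
  have "r < P\<^sup>2" using r \<open>P > 1\<close> by (intro le_less_trans[of r P]) (simp_all add: power2_eq_square)
  then have "\<not> P\<^sup>2 dvd r" using r by (auto dest: dvd_imp_le)
  moreover have l: "l \<noteq> 0" "even l" "int P dvd int l" using \<open>P > 1\<close> even_fact by (auto simp: l_def)
  moreover have "fact 20 * P dvd l\<^sup>2" by (simp add: l_def power2_eq_square)
  ultimately have inf: "infinite {t. 0 < t \<and> [t = r] (mod P\<^sup>2) \<and> admissible (l\<^sup>2) t}" (is "infinite ?T")
    by (intro infinite_admissible[OF P(1)]) auto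
  note l2 = even_square_bounds[OF l(2,1)]
  have "infinite (disc (l\<^sup>2) ` ?T)" by (rule infinite_image_disc[OF inf l2(1)]) simp
  moreover have "disc (l\<^sup>2) ` ?T \<subseteq> {d. squarefree d \<and> [d = a] (mod p) \<and>
      X1_has_quadratic_point_over (rat_adjoin_sqrt d)}"
  proof clarify
    fix t assume t: "0 < t" "[t = r] (mod P\<^sup>2)" "admissible (l\<^sup>2) t"
    have "[t = r] (mod P)" using t(2) by (rule cong_dvd_modulus_nat) simp
    then have "[int t = int r] (mod p)" unfolding P(2) by (simp add: cong_int_iff)
    moreover have "[disc (l\<^sup>2) t = int t] (mod p)"
      by (rule cong_dvd_modulus[OF disc_cong]) (use l(3) P(2) in \<open>simp add: power2_eq_square\<close>)
    ultimately have "[disc (l\<^sup>2) t = a] (mod p)" using r by (blast intro: cong_trans)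
    then show "squarefree (disc (l\<^sup>2) t) \<and> [disc (l\<^sup>2) t = a] (mod p) \<and>
        X1_has_quadratic_point_over (rat_adjoin_sqrt (disc (l\<^sup>2) t))"
      using squarefree_disc[OF l2(2) t(3)] X1_has_quadratic_point_over_disc[OF t(3) l(2,1) t(1)] by blast
  qed
  ultimately show "infinite {d. squarefree d \<and> [d = a] (mod p) \<and>
      X1_has_quadratic_point_over (rat_adjoin_sqrt d)}"
    using infinite_super by blast
next
  define l :: nat where "l = fact 20 * 2"
  have l: "l \<noteq> 0" "even l" by (simp_all add: l_def)
  note l2 = even_square_bounds[OF l(2,1)]
  \<comment> \<open>Here p = 2 and r = 2: the sieve controls t modulo p^2 = 4, as the shape of the
    ring of integers demands.\<close>
  have inf: "infinite {t. 0 < t \<and> [t = 2] (mod 2\<^sup>2) \<and> admissible (l\<^sup>2) t}" (is "infinite ?T")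
  proof (rule infinite_admissible)
    show "fact 20 * 2 dvd l\<^sup>2" by (simp add: l_def power2_eq_square)
  qed (use l in \<open>auto dest: dvd_imp_le\<close>)
  have T: "0 < t" "t mod 4 = 2" "admissible (l\<^sup>2) t" if "t \<in> ?T" for t
    using that by (auto simp: cong_def)
  have "inj_on rat_adjoin_sqrt (disc (l\<^sup>2) ` ?T)"
  proof (rule inj_onI)
    have *: "squarefree d \<and> d \<noteq> 1" if d: "d \<in> disc (l\<^sup>2) ` ?T" for d
    proof -
      obtain t where t: "d = disc (l\<^sup>2) t" "t \<in> ?T" using d by (rule imageE)
      have "int t \<le> - d" using disc_bounds(1)[OF l2(1) T(1)[OF t(2)]] t(1) by simp
      then show ?thesis using squarefree_disc[OF l2(2) T(3)[OF t(2)]] t(1) by auto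
    qed
    fix d e assume "d \<in> disc (l\<^sup>2) ` ?T" "e \<in> disc (l\<^sup>2) ` ?T" "rat_adjoin_sqrt d = rat_adjoin_sqrt e"
    then show "d = e" using * rat_adjoin_sqrt_inject by blast
  qed
  moreover have "infinite (disc (l\<^sup>2) ` ?T)" by (rule infinite_image_disc[OF inf l2(1)]) simp
  ultimately have "infinite (rat_adjoin_sqrt ` disc (l\<^sup>2) ` ?T)"
    using finite_image_iff by blast
  moreover have "rat_adjoin_sqrt ` disc (l\<^sup>2) ` ?T \<subseteq> {K. imaginary_quadratic_field K \<and>
      10 dvd class_number K \<and> X1_has_quadratic_point_over K}"
  proof (rule subsetI)
    fix K assume "K \<in> rat_adjoin_sqrt ` disc (l\<^sup>2) ` ?T"
    then obtain t where t: "t \<in> ?T" and K: "K = rat_adjoin_sqrt (disc (l\<^sup>2) t)" by blast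
    show "K \<in> {K. imaginary_quadratic_field K \<and> 10 dvd class_number K \<and> X1_has_quadratic_point_over K}"
      using ten_dvd_class_number_disc[OF T(3)[OF t] l(2,1) T(1,2)[OF t]]
        X1_has_quadratic_point_over_disc[OF T(3)[OF t] l(2,1) T(1)[OF t]] unfolding K by blast
  qed
  ultimately show "infinite {K. imaginary_quadratic_field K \<and> 10 dvd class_number K \<and>
      X1_has_quadratic_point_over K}"
    using infinite_super by blast
qed

end
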